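(* Let $S^{1,0}=\{(x,y)\in\mathbb{R}_S^{2,0}\mid x^2+y^2=1\}$ be the supercircle. Then the tangent bundle over $S^{1,0}$ is trivial (that is, isomorphic to the trivial bundle $S^{1,0}\times\mathbb{R}_S$).
   Context: $\mathbb{R}_S$ is the real Grassmann algebra on infinitely many generators $\beta_{[1]},\beta_{[2]},\dots$ with $\beta_{[i]}\beta_{[j]}=-\beta_{[j]}\beta_{[i]}$, whose elements are formal (possibly infinite) sums $x=\sum_{\underline\lambda}x_{\underline\lambda}\beta_{[\lambda_1]}\cdots\beta_{[\lambda_k]}$ with $x_{\underline\lambda}\in\mathbb{R}$, over all finite multi indices $\underline\lambda=\lambda_1\cdots\lambda_k$, $1\le\lambda_1<\cdots<\lambda_k$, $k\ge0$ (the empty multi index $\underline 0$ corresponds to $1$). $\mathbb{R}_{S_0}$ (resp. $\mathbb{R}_{S_1}$) consists of the sums involving only multi indices of even (resp. odd) length. The body map is $\epsilon(x)=x_{\underline 0}\in\mathbb{R}$, and $\sigma(x)=x-\epsilon(x)$. Put $\mathbb{R}_S^{m,0}=(\mathbb{R}_{S_0})^m$ and $\epsilon^{m,0}(x_1,\dots,x_m)=(\epsilon(x_1),\dots,\epsilon(x_m))$. A subset $U\subset\mathbb{R}_S^{m,0}$ is open in the DeWitt topology iff $U=(\epsilon^{m,0})^{-1}(V)$ for some open $V\subset\mathbb{R}^m$. For such $U$ (with $V=\epsilon^{m,0}(U)$), a function $U\to\mathbb{R}_S$ is $G^\infty$ if it has the form $\widehat f(x)=\sum_{i_1,\dots,i_m\ge0}\frac1{i_1!\cdots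 i_m!}\partial_1^{i_1}\cdots\partial_m^{i_m}f(\epsilon^{m,0}(x))\,\sigma(x_1)^{i_1}\cdots\sigma(x_m)^{i_m}$ for some $f\in C^\infty(V,\mathbb{R}_S)$ (all real coefficient functions smooth). $S^{1,0}$ is a supermanifold of dimension $(1,0)$ with the four charts: $U_{x^\pm}=\{(x,y)\in S^{1,0}\mid\pm\epsilon(x)>0\}$ with chart map $(x,y)\mapsto y$, and $U_{y^\pm}=\{(x,y)\in S^{1,0}\mid\pm\epsilon(y)>0\}$ with chart map $(x,y)\mapsto x$, each a bijection onto $(\epsilon^{1,0})^{-1}((-1,1))$. Open subsets of $S^{1,0}$ and $G^\infty$ functions on them are defined through these charts. For $p\in S^{1,0}$, the tangent space $T_pS^{1,0}$ is the $\mathbb{R}_S$-module of superderivations at $p$ of germs of $G^\infty$ functions: sums of homogeneous maps $D$ from germs at $p$ to $\mathbb{R}_S$ that are additive and satisfy $D(af)=(-1)^{|D||a|}aD(f)$ for homogeneous $a\in\mathbb{R}_S$ and $D(fg)=D(f)g(p)+(-1)^{|D||f|}f(p)D(g)$ for homogeneous germs $f,g$. The tangent bundle is the disjoint union of the $T_pS^{1,0}$ with its projection to $S^{1,0}$. It is trivial (isomorphic to $S^{1,0}\times\mathbb{R}_S$) if there are even $D_p\in T_pS^{1,0}$, $p\in S^{1,0}$, such that $p\mapsto D_pf$ is $G^\infty$ on $U$ for every $G^\infty$ function $f$ on every open $U\subset S^{1,0}$, and such that $(p,\lambda)\mapsto\lambda D_p$ is a bijection from $S^{1,0}\times\mathbb{R}_S$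 onto the tangent bundle. *)

theory Defs
  imports "HOL-Analysis.Analysis" "HOL-Library.FSet" "HOL-Library.FuncSet"
begin

section \<open>The Grassmann algebra\<close>

text \<open>
  An element is the family of its real coefficients. A strictly increasing multi index is
  encoded as the finite set of its entries; the generators are numbered from 0 instead of 1.
\<close>

datatype grassmann = Grassmann (coeff: "nat fset \<Rightarrow> real")

lemma grassmann_eqI: "(\<And>A. coeff x A = coeff y A) \<Longrightarrow> x = y"
  by (rule grassmann.expand) auto

definition inversions :: "nat fset \<Rightarrow> nat fset \<Rightarrow> (nat \<times> nat) set" where
  "inversions A B = {(a, b). a |\<in>| A \<and> b |\<in>| B \<and> b < a}"

text \<open>
  For disjoint \<open>A\<close> and \<open>B\<close>, sorting the concatenation of the two increasing sequences takes one
  transposition of neighbours per inversion, so the product of the two monomials is this sign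
  times the monomial of \<open>A |\<union>| B\<close>. If \<open>A\<close> and \<open>B\<close> meet, the product is 0.
\<close>

definition shuffle_sign :: "nat fset \<Rightarrow> nat fset \<Rightarrow> real" where
  "shuffle_sign A B = (-1) ^ card (inversions A B)"

lemma finite_inversions [simp]: "finite (inversions A B)"
  by (rule finite_subset[of _ "fset A \<times> fset B"]) (auto simp: inversions_def)

lemma finite_fsubsets [simp]: "finite {A. A |\<subseteq>| C}"
proof -
  have "{A. A |\<subseteq>| C} = fset (fPow C)" by auto
  then show ?thesis by simp
qed

lemma shuffle_sign_union_left:
  assumes "A |\<inter>| B = {||}"
  shows "shuffle_sign (A |\<union>| B) C = shuffle_sign A C * shuffle_sign B C"
proof -
  have "inversions (A |\<union>| B) C = inversions A C \<union> inversions B C"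
    by (auto simp: inversions_def)
  moreover have "inversions A C \<inter> inversions B C = {}"
    using assms by (auto simp: inversions_def)
  ultimately show ?thesis
    by (simp add: shuffle_sign_def card_Un_disjoint power_add)
qed

lemma shuffle_sign_union_right:
  assumes "B |\<inter>| C = {||}"
  shows "shuffle_sign A (B |\<union>| C) = shuffle_sign A B * shuffle_sign A C"
proof -
  have "inversions A (B |\<union>| C) = inversions A B \<union> inversions A C"
    by (auto simp: inversions_def)
  moreover have "inversions A B \<inter> inversions A C = {}"
    using assms by (auto simp: inversions_def)
  ultimately show ?thesis
    by (simp add: shuffle_sign_def card_Un_disjoint power_add)
qed

lemma shuffle_sign_empty [simp]: "shuffle_sign {||} A = 1" "shuffle_sign A {||} = 1"
  by (simp_all add: shuffle_sign_def inversions_def)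

instantiation grassmann :: real_algebra_1
begin

definition zero_grassmann :: grassmann where
  "0 = Grassmann (\<lambda>_. 0)"

definition one_grassmann :: grassmann where
  "1 = Grassmann (\<lambda>A. if A = {||} then 1 else 0)"

definition plus_grassmann :: "grassmann \<Rightarrow> grassmann \<Rightarrow> grassmann" where
  "x + y = Grassmann (\<lambda>A. coeff x A + coeff y A)"

definition minus_grassmann :: "grassmann \<Rightarrow> grassmann \<Rightarrow> grassmann" where
  "x - y = Grassmann (\<lambda>A. coeff x A - coeff y A)"

definition uminus_grassmann :: "grassmann \<Rightarrow> grassmann" where
  "- x = Grassmann (\<lambda>A. - coeff x A)"

definition scaleR_grassmann :: "real \<Rightarrow> grassmann \<Rightarrow> grassmann" where
  "r *\<^sub>R x = Grassmann (\<lambda>A. r * coeff x A)"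

definition times_grassmann :: "grassmann \<Rightarrow> grassmann \<Rightarrow> grassmann" where
  "x * y = Grassmann (\<lambda>C. \<Sum>A | A |\<subseteq>| C. shuffle_sign A (C |-| A) * coeff x A * coeff y (C |-| A))"

lemma coeff_simps:
  "coeff 0 A = 0"
  "coeff 1 A = (if A = {||} then 1 else 0)"
  "coeff (x + y) A = coeff x A + coeff y A"
  "coeff (x - y) A = coeff x A - coeff y A"
  "coeff (- x) A = - coeff x A"
  "coeff (r *\<^sub>R x) A = r * coeff x A"
  by (simp_all add: zero_grassmann_def one_grassmann_def plus_grassmann_def minus_grassmann_def
      uminus_grassmann_def scaleR_grassmann_def)

lemma coeff_times:
  "coeff (x * y) C = (\<Sum>A | A |\<subseteq>| C. shuffle_sign A (C |-| A) * coeff x A * coeff y (C |-| A))"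
  by (simp add: times_grassmann_def)

lemma grassmann_mult_assoc: "(x * y) * z = x * (y * z)" for x y z :: grassmann
proof (rule grassmann_eqI)
  fix E
  let ?l = "\<lambda>D A. shuffle_sign D (E |-| D) * (shuffle_sign A (D |-| A) * coeff x A * coeff y (D |-| A))
    * coeff z (E |-| D)"
  let ?r = "\<lambda>A B. shuffle_sign A (E |-| A) * coeff x A *
    (shuffle_sign B (E |-| A |-| B) * coeff y B * coeff z (E |-| A |-| B))"
  have "coeff ((x * y) * z) E = (\<Sum>D | D |\<subseteq>| E. \<Sum>A | A |\<subseteq>| D. ?l D A)"
    by (simp add: coeff_times sum_distrib_left sum_distrib_right mult.assoc)
  also have "\<dots> = (\<Sum>(D, A) \<in> (SIGMA D:{D. D |\<subseteq>| E}. {A. A |\<subseteq>| D}). ?l D A)"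
    by (rule sum.Sigma) auto
  also have "\<dots> = (\<Sum>(A, B) \<in> (SIGMA A:{A. A |\<subseteq>| E}. {B. B |\<subseteq>| E |-| A}). ?r A B)"
  proof (rule sum.reindex_bij_witness[where i = "\<lambda>(A, B). (A |\<union>| B, A)" and j = "\<lambda>(D, A). (A, D |-| A)"])
    fix p assume p: "p \<in> (SIGMA D:{D. D |\<subseteq>| E}. {A. A |\<subseteq>| D})"
    then obtain D A where [simp]: "p = (D, A)" and D: "D |\<subseteq>| E" and A: "A |\<subseteq>| D" by auto
    define B C where "B = D |-| A" and "C = E |-| D"
    have DE: "D = A |\<union>| B" "E |-| A = B |\<union>| C" "E |-| A |-| B = C" "(B |\<union>| C) |-| B = C"
      and disj: "A |\<inter>| B = {||}" "B |\<inter>| C = {||}"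
      using A D by (auto simp: B_def C_def)
    show "(case case p of (D, A) \<Rightarrow> (A, D |-| A) of (A, B) \<Rightarrow> (A |\<union>| B, A)) = p"
      using A by auto
    show "(case p of (D, A) \<Rightarrow> (A, D |-| A)) \<in> (SIGMA A:{A. A |\<subseteq>| E}. {B. B |\<subseteq>| E |-| A})"
      using A D by auto
    have "?r A B = ?l D A"
      unfolding B_def[symmetric] C_def[symmetric] DE(2,3)
      unfolding DE(1) shuffle_sign_union_left[OF disj(1)] shuffle_sign_union_right[OF disj(2)]
      by (simp add: DE(4) mult_ac)
    then show "(case (case p of (D, A) \<Rightarrow> (A, D |-| A)) of (A, B) \<Rightarrow> ?r A B) = (case p of (D, A) \<Rightarrow> ?l D A)"
      by (simp add: B_def)
  qed auto
  also have "\<dots> = (\<Sum>A | A |\<subseteq>| E. \<Sum>B | B |\<subseteq>| E |-| A. ?r A B)"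
    by (rule sum.Sigma[symmetric]) auto
  also have "\<dots> = coeff (x * (y * z)) E"
    by (simp add: coeff_times sum_distrib_left)
  finally show "coeff ((x * y) * z) E = coeff (x * (y * z)) E" .
qed

lemma grassmann_mult_1_left: "1 * x = x" for x :: grassmann
proof (rule grassmann_eqI)
  fix C
  have "coeff (1 * x) C = (\<Sum>A | A |\<subseteq>| C. if A = {||} then coeff x C else 0)"
    unfolding coeff_times by (rule sum.cong) (auto simp: coeff_simps)
  then show "coeff (1 * x) C = coeff x C" by simp
qed

lemma grassmann_mult_1_right: "x * 1 = x" for x :: grassmann
proof (rule grassmann_eqI)
  fix C
  have "coeff (x * 1) C = (\<Sum>A | A |\<subseteq>| C. if A = C then coeff x C else 0)"
    unfolding coeff_times by (rule sum.cong) (auto simp: coeff_simps)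
  then show "coeff (x * 1) C = coeff x C" by simp
qed

instance
proof
  fix x y z :: grassmann and r s :: real
  show "(x * y) * z = x * (y * z)" by (rule grassmann_mult_assoc)
  show "1 * x = x" by (rule grassmann_mult_1_left)
  show "x * 1 = x" by (rule grassmann_mult_1_right)
  show "(x + y) * z = x * z + y * z" "x * (y + z) = x * y + x * z"
    by (rule grassmann_eqI, simp add: coeff_times coeff_simps algebra_simps sum.distrib)+
  show "r *\<^sub>R x * y = r *\<^sub>R (x * y)" "x * r *\<^sub>R y = r *\<^sub>R (x * y)"
    by (rule grassmann_eqI, simp add: coeff_times coeff_simps sum_distrib_left mult_ac)+
  have "coeff (0 :: grassmann) {||} \<noteq> coeff 1 {||}" by (simp add: coeff_simps)
  then show "(0 :: grassmann) \<noteq> 1" by auto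
qed (rule grassmann_eqI, simp add: coeff_simps algebra_simps)+

end

definition generator :: "nat \<Rightarrow> grassmann" where
  "generator i = Grassmann (\<lambda>A. if A = {|i|} then 1 else 0)"

lemma generator_anticommute: "generator i * generator j = - (generator j * generator i)"
proof (rule grassmann_eqI)
  fix C
  have prod: "coeff (generator k * generator l) C =
      (if k \<noteq> l \<and> C = {|k, l|} then if l < k then -1 else 1 else 0)" for k l
  proof -
    have "coeff (generator k * generator l) C =
      (\<Sum>A | A |\<subseteq>| C. if A = {|k|} then
         (if C |-| {|k|} = {|l|} then shuffle_sign {|k|} {|l|} else 0) else 0)"
      unfolding coeff_times by (rule sum.cong) (auto simp: generator_def)
    also have "\<dots> = (if k |\<in>| C \<and> C |-| {|k|} = {|l|} then shuffle_sign {|k|} {|l|} else 0)"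
      by auto
    also have "k |\<in>| C \<and> C |-| {|k|} = {|l|} \<longleftrightarrow> k \<noteq> l \<and> C = {|k, l|}"
      by auto
    also have "shuffle_sign {|k|} {|l|} = (if l < k then -1 else 1)"
    proof -
      have "inversions {|k|} {|l|} = (if l < k then {(k, l)} else {})"
        by (auto simp: inversions_def)
      then show ?thesis by (simp add: shuffle_sign_def)
    qed
    finally show ?thesis .
  qed
  show "coeff (generator i * generator j) C = coeff (- (generator j * generator i)) C"
    by (auto simp: prod coeff_simps)
qed

text \<open>Only the parity of \<open>i\<close> matters: the values 0 and 1 give the even and the odd part.\<close>

definition graded_part :: "nat \<Rightarrow> grassmann set" where
  "graded_part i = {x. \<forall>A. coeff x A \<noteq> 0 \<longrightarrow> (even (fcard A) \<longleftrightarrow> even i)}"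

definition body :: "grassmann \<Rightarrow> real" where
  "body x = coeff x {||}"

definition soul :: "grassmann \<Rightarrow> grassmann" where
  "soul x = x - of_real (body x)"

lemma coeff_of_real: "coeff (of_real r) A = (if A = {||} then r else 0)"
  by (simp add: of_real_def coeff_simps)

lemma coeff_mult_soul_power_eq_0: "fcard A < n \<Longrightarrow> coeff (a * soul x ^ n) A = 0"
proof -
  have pow: "fcard A < n \<Longrightarrow> coeff (soul x ^ n) A = 0" for A
  proof (induction n arbitrary: A)
    case (Suc n)
    have "coeff (soul x) B * coeff (soul x ^ n) (A |-| B) = 0" if "B |\<subseteq>| A" for B
    proof (cases "B = {||}")
      case False
      with that have "A |-| B |\<subset>| A" by auto
      then have "fcard (A |-| B) < fcard A" by (rule pfsubset_fcard_mono)
      with Suc show ?thesis by auto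
    qed (simp add: soul_def body_def coeff_simps coeff_of_real)
    then show ?case by (auto simp: coeff_times mult.assoc intro!: sum.neutral)
  qed simp
  assume A: "fcard A < n"
  have "coeff (soul x ^ n) (A |-| B) = 0" for B
    by (rule pow) (meson A fcard_mono fminus_fsubset le_less_trans)
  then show ?thesis by (simp add: coeff_times)
qed

section \<open>G-infinity functions of one even variable\<close>

definition dewitt_open :: "grassmann set \<Rightarrow> bool" where
  "dewitt_open U \<longleftrightarrow> (\<exists>V. open V \<and> U = {x \<in> graded_part 0. body x \<in> V})"

definition smooth_on :: "real set \<Rightarrow> (real \<Rightarrow> grassmann) \<Rightarrow> bool" where
  "smooth_on V f \<longleftrightarrow>
    (\<forall>A n. \<forall>t\<in>V. ((deriv ^^ n) (\<lambda>s. coeff (f s) A)) differentiable (at t))"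

definition nth_deriv :: "nat \<Rightarrow> (real \<Rightarrow> grassmann) \<Rightarrow> real \<Rightarrow> grassmann" where
  "nth_deriv n f t = Grassmann (\<lambda>A. (deriv ^^ n) (\<lambda>s. coeff (f s) A) t)"

text \<open>
  The series is a formal one: by \<open>coeff_mult_soul_power_eq_0\<close> each coefficient is a finite sum.
\<close>

definition G_extension :: "(real \<Rightarrow> grassmann) \<Rightarrow> grassmann \<Rightarrow> grassmann" where
  "G_extension f x =
    Grassmann (\<lambda>A. \<Sum>n. coeff ((1 / fact n) *\<^sub>R nth_deriv n f (body x) * soul x ^ n) A)"

definition G_infty :: "grassmann set \<Rightarrow> (grassmann \<Rightarrow> grassmann) \<Rightarrow> bool" where
  "G_infty U F \<longleftrightarrow>
    dewitt_open U \<and> (\<exists>f. smooth_on (body ` U) f \<and> (\<forall>x\<in>U. F x = G_extension f x))"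

section \<open>Tangent bundles of supermanifolds of dimension \<open>(1,0)\<close>\<close>

text \<open>
  A chart is a pair of its domain and its chart map. Functions on an open set are represented by
  functions on the whole type, whose values off that set are irrelevant.
\<close>

type_synonym 'a atlas = "('a set \<times> ('a \<Rightarrow> grassmann)) set"

definition super_open :: "'a set \<Rightarrow> 'a atlas \<Rightarrow> 'a set \<Rightarrow> bool" where
  "super_open M \<A> U \<longleftrightarrow> U \<subseteq> M \<and> (\<forall>(C, \<phi>)\<in>\<A>. dewitt_open (\<phi> ` (U \<inter> C)))"

definition G_infty_on :: "'a set \<Rightarrow> 'a atlas \<Rightarrow> 'a set \<Rightarrow> ('a \<Rightarrow> grassmann) \<Rightarrow> bool" where
  "G_infty_on M \<A> U f \<longleftrightarrow>
    super_open M \<A> U \<and> (\<forall>(C, \<phi>)\<in>\<A>. G_infty (\<phi> ` (U \<inter> C)) (f \<circ> inv_into C \<phi>))"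

definition local_functions :: "'a set \<Rightarrow> 'a atlas \<Rightarrow> 'a \<Rightarrow> ('a set \<times> ('a \<Rightarrow> grassmann)) set" where
  "local_functions M \<A> p = {(U, f). p \<in> U \<and> G_infty_on M \<A> U f}"

definition germ_rel :: "'a set \<Rightarrow> 'a atlas \<Rightarrow> 'a \<Rightarrow> ('a set \<times> ('a \<Rightarrow> grassmann)) rel" where
  "germ_rel M \<A> p = {((U, f), (V, g)).
    (U, f) \<in> local_functions M \<A> p \<and> (V, g) \<in> local_functions M \<A> p \<and>
    (\<exists>W. super_open M \<A> W \<and> p \<in> W \<and> W \<subseteq> U \<inter> V \<and> (\<forall>q\<in>W. f q = g q))}"

type_synonym 'a germ = "('a set \<times> ('a \<Rightarrow> grassmann)) set"

definition germs :: "'a set \<Rightarrow> 'a atlas \<Rightarrow> 'a \<Rightarrow> 'a germ set" where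
  "germs M \<A> p = local_functions M \<A> p // germ_rel M \<A> p"

definition germ :: "'a set \<Rightarrow> 'a atlas \<Rightarrow> 'a \<Rightarrow> 'a set \<Rightarrow> ('a \<Rightarrow> grassmann) \<Rightarrow> 'a germ" where
  "germ M \<A> p U f = germ_rel M \<A> p `` {(U, f)}"

text \<open>
  Homogeneous superderivations of parity \<open>d\<close>. Homogeneity of a germ of parity \<open>i\<close> is expressed by
  a representative with values in \<open>graded_part i\<close>. Derivations are extensional on the set of germs,
  so that equality of functions is equality of derivations.
\<close>

definition superderivation ::
    "'a set \<Rightarrow> 'a atlas \<Rightarrow> 'a \<Rightarrow> nat \<Rightarrow> ('a germ \<Rightarrow> grassmann) \<Rightarrow> bool" where
  "superderivation M \<A> p d D \<longleftrightarrow>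
    D \<in> extensional (germs M \<A> p) \<and>
    (\<forall>(U, f) \<in> local_functions M \<A> p. \<forall>i.
      f ` U \<subseteq> graded_part i \<longrightarrow> D (germ M \<A> p U f) \<in> graded_part (d + i)) \<and>
    (\<forall>(U, f) \<in> local_functions M \<A> p. \<forall>(V, g) \<in> local_functions M \<A> p.
      D (germ M \<A> p (U \<inter> V) (\<lambda>q. f q + g q)) = D (germ M \<A> p U f) + D (germ M \<A> p V g)) \<and>
    (\<forall>(U, f) \<in> local_functions M \<A> p. \<forall>j. \<forall>a \<in> graded_part j.
      D (germ M \<A> p U (\<lambda>q. a * f q)) = (-1) ^ (d * j) * a * D (germ M \<A> p U f)) \<and>
    (\<forall>(U, f) \<in> local_functions M \<A> p. \<forall>(V, g) \<in> local_functions M \<A> p. \<forall>i j.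
      f ` U \<subseteq> graded_part i \<longrightarrow> g ` V \<subseteq> graded_part j \<longrightarrow>
      D (germ M \<A> p (U \<inter> V) (\<lambda>q. f q * g q)) =
        D (germ M \<A> p U f) * g p + (-1) ^ (d * i) * f p * D (germ M \<A> p V g))"

text \<open>
  Superderivations of the same parity are closed under addition, so a sum of homogeneous ones has
  the form below; the zero map is homogeneous of both parities.
\<close>

definition tangent_space :: "'a set \<Rightarrow> 'a atlas \<Rightarrow> 'a \<Rightarrow> ('a germ \<Rightarrow> grassmann) set" where
  "tangent_space M \<A> p =
    {(\<lambda>G\<in>germs M \<A> p. D0 G + D1 G) | D0 D1.
      superderivation M \<A> p 0 D0 \<and> superderivation M \<A> p 1 D1}"

definition tangent_scale ::
    "'a set \<Rightarrow> 'a atlas \<Rightarrow> 'a \<Rightarrow> grassmann \<Rightarrow> ('a germ \<Rightarrow> grassmann) \<Rightarrow> ('a germ \<Rightarrow> grassmann)" where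
  "tangent_scale M \<A> p l D = (\<lambda>G\<in>germs M \<A> p. l * D G)"

definition tangent_bundle :: "'a set \<Rightarrow> 'a atlas \<Rightarrow> ('a \<times> ('a germ \<Rightarrow> grassmann)) set" where
  "tangent_bundle M \<A> = (SIGMA p:M. tangent_space M \<A> p)"

definition trivial_tangent_bundle :: "'a set \<Rightarrow> 'a atlas \<Rightarrow> bool" where
  "trivial_tangent_bundle M \<A> \<longleftrightarrow> (\<exists>D.
    (\<forall>p\<in>M. superderivation M \<A> p 0 (D p)) \<and>
    (\<forall>U f. G_infty_on M \<A> U f \<longrightarrow> G_infty_on M \<A> U (\<lambda>p. D p (germ M \<A> p U f))) \<and>
    bij_betw (\<lambda>(p, l). (p, tangent_scale M \<A> p l (D p))) (M \<times> UNIV) (tangent_bundle M \<A>))"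

section \<open>The supercircle\<close>

definition supercircle :: "(grassmann \<times> grassmann) set" where
  "supercircle = {(x, y). x \<in> graded_part 0 \<and> y \<in> graded_part 0 \<and> x\<^sup>2 + y\<^sup>2 = 1}"

definition supercircle_atlas :: "(grassmann \<times> grassmann) atlas" where
  "supercircle_atlas =
    {({(x, y) \<in> supercircle. body x > 0}, snd),
     ({(x, y) \<in> supercircle. - body x > 0}, snd),
     ({(x, y) \<in> supercircle. body y > 0}, fst),
     ({(x, y) \<in> supercircle. - body y > 0}, fst)}"

end

theory Submission
  imports Defs
begin

text \<open>
  The tangent bundle is trivialised by the rotation field \<open>x \<partial>/\<partial>y - y \<partial>/\<partial>x\<close>. In the two charts with
  coordinate \<open>y\<close> it is \<open>x \<partial>/\<partial>y\<close>, in the two charts with coordinate \<open>x\<close> it is \<open>-y \<partial>/\<partial>x\<close>; the two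
  expressions agree where the charts meet because differentiating \<open>x\<^sup>2 + y\<^sup>2 = 1\<close> with respect to \<open>y\<close>
  gives \<open>x (dx/dy) = -y\<close> (\<open>gderiv_height\<close>). On the chart with coordinate \<open>y\<close> the body of \<open>x\<close> does
  not vanish, so the component \<open>x\<close> is invertible in the Grassmann algebra, and likewise \<open>-y\<close> on the
  others. Hence the field spans the tangent space at every point, provided that each tangent space
  is free of rank one, spanned by the coordinate derivation of any chart around the point.

  That last fact is \<open>superderivation_in_chart\<close>: a superderivation \<open>D\<close> at \<open>p\<close> satisfies
  \<open>D f = D \<phi> * (df/d\<phi>)(p)\<close> for a chart \<open>\<phi>\<close>. It rests on Hadamard's lemma. If \<open>b\<close> is the
  body of \<open>\<phi> p\<close>, a smooth \<open>f\<close> is \<open>f b + (t - b) g\<close> with \<open>g\<close> smooth, so the defect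
  \<open>D f - D \<phi> * (df/d\<phi>)(p)\<close> is the corresponding defect of \<open>g\<close> times the soul of \<open>\<phi> p\<close>. Iterating,
  the defect is divisible by every power of that soul. The soul need not be nilpotent, but its
  \<open>n\<close>-th power has no coefficients of degree less than \<open>n\<close>, so the defect is zero
  (\<open>soul_descent\<close>). The derivation is only ever applied to finite expressions, which is why its
  algebraic rules suffice.

  The same descent proves that the formal Taylor extension from real to Grassmann arguments respects
  products (\<open>G_extension_mult\<close>) and composition with real functions (\<open>G_extension_compose\<close>), since
  extension turns the factor \<open>t - b\<close> into the soul. Multiplicativity gives inverses of even
  elements with nonzero body and the Grassmann square root of \<open>1 - x\<^sup>2\<close>, which inverts the chart
  maps. Composition makes a function that is smooth in one chart smooth in the others; this
  is needed because the factors \<open>g\<close> above are constructed in one chart, while a germ has to be a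
  G-infinity function in all of them.
\<close>

section \<open>Smooth real functions\<close>

text \<open>
  Smoothness is proved by induction on the number of derivatives. Only plain differentiability of
  the last derivative is recorded: continuity of the earlier ones follows.
\<close>

definition times_differentiable :: "nat \<Rightarrow> real set \<Rightarrow> (real \<Rightarrow> real) \<Rightarrow> bool" where
  "times_differentiable n V u \<longleftrightarrow> (\<forall>k<n. \<forall>t\<in>V. (deriv ^^ k) u differentiable (at t))"

definition smooth_real :: "real set \<Rightarrow> (real \<Rightarrow> real) \<Rightarrow> bool" where
  "smooth_real V u \<longleftrightarrow> (\<forall>n. times_differentiable n V u)"

lemma smooth_real_iff: "smooth_real V u \<longleftrightarrow> (\<forall>n. \<forall>t\<in>V. (deriv ^^ n) u differentiable (at t))"
  unfolding smooth_real_def times_differentiable_def by blast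

lemma times_differentiable_0 [simp]: "times_differentiable 0 V u"
  by (simp add: times_differentiable_def)

lemma times_differentiable_Suc:
  "times_differentiable (Suc n) V u \<longleftrightarrow>
    (\<forall>t\<in>V. u differentiable (at t)) \<and> times_differentiable n V (deriv u)"
  unfolding times_differentiable_def All_less_Suc2 by (simp add: funpow_swap1)

lemma times_differentiable_mono:
  "times_differentiable n V u \<Longrightarrow> m \<le> n \<Longrightarrow> times_differentiable m V u"
  by (auto simp: times_differentiable_def)

lemma higher_deriv_cong_open:
  fixes u v :: "real \<Rightarrow> real"
  assumes "open V" "\<And>t. t \<in> V \<Longrightarrow> u t = v t" "t \<in> V"
  shows "(deriv ^^ n) u t = (deriv ^^ n) v t"
  using assms(3)
proof (induction n arbitrary: t)
  case (Suc n)
  have "eventually (\<lambda>s. (deriv ^^ n) u s = (deriv ^^ n) v s) (nhds t)"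
    using Suc assms(1) by (auto simp: eventually_nhds)
  then show ?case by (simp add: deriv_cong_ev)
qed (simp add: assms)

lemma deriv_cong_open:
  fixes u v :: "real \<Rightarrow> real"
  assumes "open V" "\<And>t. t \<in> V \<Longrightarrow> u t = v t" "t \<in> V"
  shows "deriv u t = deriv v t"
  by (rule deriv_cong_ev) (use assms in \<open>auto simp: eventually_nhds\<close>)

lemma differentiable_cong_open:
  fixes u v :: "real \<Rightarrow> real"
  assumes "open V" "\<And>t. t \<in> V \<Longrightarrow> u t = v t" "t \<in> V" "v differentiable (at t)"
  shows "u differentiable (at t)"
  using assms by (metis differentiable_def has_derivative_transform_within_open)

lemma times_differentiable_cong:
  assumes "open V" "\<And>t. t \<in> V \<Longrightarrow> u t = v t" "times_differentiable n V v"
  shows "times_differentiable n V u"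
  unfolding times_differentiable_def
proof (intro allI impI ballI)
  fix k t assume "k < n" "t \<in> V"
  with assms show "(deriv ^^ k) u differentiable (at t)"
    by (intro differentiable_cong_open[OF assms(1), of "(deriv ^^ k) u" "(deriv ^^ k) v"]
        higher_deriv_cong_open[OF assms(1)]) (auto simp: times_differentiable_def)
qed

lemma DERIV_deriv: "(u :: real \<Rightarrow> real) differentiable (at t) \<Longrightarrow> DERIV u t :> deriv u t"
  using DERIV_deriv_iff_real_differentiable by blast

lemma times_differentiable_SucI:
  assumes "open V" "\<And>t. t \<in> V \<Longrightarrow> DERIV u t :> u' t" "times_differentiable n V u'"
  shows "times_differentiable (Suc n) V u"
  unfolding times_differentiable_Suc
proof
  show "\<forall>t\<in>V. u differentiable (at t)"
    using assms(2) real_differentiable_def by blast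
  show "times_differentiable n V (deriv u)"
    using assms by (intro times_differentiable_cong[of V "deriv u" u']) (auto intro: DERIV_imp_deriv)
qed

lemma times_differentiable_const: "times_differentiable n V (\<lambda>_. c)"
proof (induction n arbitrary: c)
  case (Suc n)
  show ?case
    unfolding times_differentiable_Suc by (simp add: Suc)
qed simp

lemma times_differentiable_id: "times_differentiable n V (\<lambda>t. t)"
  by (cases n) (simp_all add: times_differentiable_Suc times_differentiable_const)

lemma times_differentiable_add:
  assumes "open V" "times_differentiable n V u" "times_differentiable n V v"
  shows "times_differentiable n V (\<lambda>t. u t + v t)"
  using assms(2,3)
proof (induction n arbitrary: u v)
  case (Suc n)
  then show ?case
    by (intro times_differentiable_SucI[OF assms(1), where u' = "\<lambda>t. deriv u t + deriv v t"])
       (auto simp: times_differentiable_Suc intro!: DERIV_add DERIV_deriv)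
qed simp

lemma times_differentiable_mult:
  assumes "open V" "times_differentiable n V u" "times_differentiable n V v"
  shows "times_differentiable n V (\<lambda>t. u t * v t)"
  using assms(2,3)
proof (induction n arbitrary: u v)
  case (Suc n)
  have "times_differentiable n V u" "times_differentiable n V v"
    using Suc.prems by (auto intro: times_differentiable_mono)
  with Suc show ?case
    by (intro times_differentiable_SucI[OF assms(1), where u' = "\<lambda>t. deriv u t * v t + deriv v t * u t"]
        times_differentiable_add[OF assms(1)])
       (auto simp: times_differentiable_Suc intro!: DERIV_mult DERIV_deriv)
qed simp

lemma times_differentiable_compose:
  assumes "open V" "\<And>t. t \<in> V \<Longrightarrow> p t \<in> W" "times_differentiable n W u" "times_differentiable n V p"
  shows "times_differentiable n V (\<lambda>t. u (p t))"
  using assms(3,4)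
proof (induction n arbitrary: u)
  case (Suc n)
  show ?case
  proof (rule times_differentiable_SucI[OF assms(1)])
    fix t assume "t \<in> V"
    with Suc.prems assms(2) show "DERIV (\<lambda>t. u (p t)) t :> deriv u (p t) * deriv p t"
      by (intro DERIV_chain2[OF DERIV_deriv DERIV_deriv]) (auto simp: times_differentiable_Suc)
  next
    have "times_differentiable n V p"
      using Suc.prems by (auto intro: times_differentiable_mono)
    then show "times_differentiable n V (\<lambda>t. deriv u (p t) * deriv p t)"
      using Suc by (intro times_differentiable_mult[OF assms(1)]) (auto simp: times_differentiable_Suc)
  qed
qed simp

lemma smooth_real_const: "smooth_real V (\<lambda>_. c)"
  by (simp add: smooth_real_def times_differentiable_const)

lemma smooth_real_id: "smooth_real V (\<lambda>t. t)"
  by (simp add: smooth_real_def times_differentiable_id)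

lemma smooth_real_add:
  "open V \<Longrightarrow> smooth_real V u \<Longrightarrow> smooth_real V v \<Longrightarrow> smooth_real V (\<lambda>t. u t + v t)"
  by (simp add: smooth_real_def times_differentiable_add)

lemma smooth_real_mult:
  "open V \<Longrightarrow> smooth_real V u \<Longrightarrow> smooth_real V v \<Longrightarrow> smooth_real V (\<lambda>t. u t * v t)"
  by (simp add: smooth_real_def times_differentiable_mult)

lemma smooth_real_cong:
  assumes "open V" "\<And>t. t \<in> V \<Longrightarrow> u t = v t" "smooth_real V v"
  shows "smooth_real V u"
  unfolding smooth_real_def
proof
  fix n show "times_differentiable n V u"
    by (rule times_differentiable_cong[OF assms(1,2)]) (use assms(3) in \<open>auto simp: smooth_real_def\<close>)
qed

lemma smooth_real_compose:
  assumes "open V" "\<And>t. t \<in> V \<Longrightarrow> p t \<in> W" "smooth_real W u" "smooth_real V p"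
  shows "smooth_real V (\<lambda>t. u (p t))"
  unfolding smooth_real_def
proof
  fix n show "times_differentiable n V (\<lambda>t. u (p t))"
    by (rule times_differentiable_compose[OF assms(1,2)])
       (use assms(3,4) in \<open>auto simp: smooth_real_def\<close>)
qed

lemma smooth_real_subset: "smooth_real V u \<Longrightarrow> W \<subseteq> V \<Longrightarrow> smooth_real W u"
  unfolding smooth_real_iff by blast

lemma smooth_real_higher_deriv: "smooth_real V u \<Longrightarrow> smooth_real V ((deriv ^^ n) u)"
  unfolding smooth_real_iff funpow_add[symmetric, THEN fun_cong, unfolded comp_apply] by blast

lemma smooth_real_DERIV: "smooth_real V u \<Longrightarrow> t \<in> V \<Longrightarrow> DERIV ((deriv ^^ n) u) t :> (deriv ^^ Suc n) u t"
  by (auto simp: smooth_real_iff intro!: DERIV_deriv)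

lemma smooth_real_continuous_on: "smooth_real V u \<Longrightarrow> continuous_on V u"
  by (intro continuous_at_imp_continuous_on ballI DERIV_isCont) (use smooth_real_DERIV[of V u _ 0] in auto)

lemma smooth_real_sum:
  assumes "open V" "\<And>i. i \<in> I \<Longrightarrow> smooth_real V (u i)"
  shows "smooth_real V (\<lambda>t. \<Sum>i\<in>I. u i t)"
  using assms(2)
proof (induction I rule: infinite_finite_induct)
  case (insert i I)
  then have "smooth_real V (\<lambda>t. u i t + (\<Sum>i\<in>I. u i t))"
    by (intro smooth_real_add[OF assms(1)]) auto
  with insert show ?case by simp
qed (simp_all add: smooth_real_const)

lemma smooth_real_powr: "smooth_real {0<..} (\<lambda>t. t powr a)"
proof -
  have "times_differentiable n {0<..} (\<lambda>t. t powr a)" for n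
  proof (induction n arbitrary: a)
    case (Suc n)
    show ?case
      by (rule times_differentiable_SucI[where u' = "\<lambda>t. a * t powr (a - 1)"])
         (auto intro: has_real_derivative_powr times_differentiable_mult[OF _ times_differentiable_const Suc])
  qed simp
  then show ?thesis by (simp add: smooth_real_def)
qed

lemma higher_deriv_add:
  assumes "open V" "smooth_real V u" "smooth_real V v" "t \<in> V"
  shows "(deriv ^^ n) (\<lambda>t. u t + v t) t = (deriv ^^ n) u t + (deriv ^^ n) v t"
  using assms(4)
proof (induction n arbitrary: t)
  case (Suc n)
  have d: "((\<lambda>t. (deriv ^^ n) u t + (deriv ^^ n) v t) has_real_derivative
      (deriv ^^ Suc n) u t + (deriv ^^ Suc n) v t) (at t)"
    by (intro DERIV_add smooth_real_DERIV[OF _ Suc.prems] assms)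
  have e: "(deriv ^^ Suc n) (\<lambda>t. u t + v t) t = deriv (\<lambda>t. (deriv ^^ n) u t + (deriv ^^ n) v t) t"
    unfolding funpow.simps comp_apply by (rule deriv_cong_open[OF assms(1) _ Suc.prems]) (rule Suc.IH)
  show ?case unfolding e by (rule DERIV_imp_deriv[OF d])
qed simp

lemma higher_deriv_cmult:
  assumes "open V" "smooth_real V u" "t \<in> V"
  shows "(deriv ^^ n) (\<lambda>t. c * u t) t = c * (deriv ^^ n) u t"
  using assms(3)
proof (induction n arbitrary: t)
  case (Suc n)
  have d: "((\<lambda>t. c * (deriv ^^ n) u t) has_real_derivative c * (deriv ^^ Suc n) u t) (at t)"
    by (intro DERIV_cmult smooth_real_DERIV[OF _ Suc.prems] assms)
  have e: "(deriv ^^ Suc n) (\<lambda>t. c * u t) t = deriv (\<lambda>t. c * (deriv ^^ n) u t) t"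
    unfolding funpow.simps comp_apply by (rule deriv_cong_open[OF assms(1) _ Suc.prems]) (rule Suc.IH)
  show ?case unfolding e by (rule DERIV_imp_deriv[OF d])
qed simp

lemma higher_deriv_zero: "(deriv ^^ n) (\<lambda>_. 0 :: real) = (\<lambda>_. 0)"
  by (induction n) simp_all

lemma higher_deriv_sum:
  assumes "open V" "\<And>i. i \<in> I \<Longrightarrow> smooth_real V (u i)" "t \<in> V"
  shows "(deriv ^^ n) (\<lambda>t. \<Sum>i\<in>I. u i t) t = (\<Sum>i\<in>I. (deriv ^^ n) (u i) t)"
  using assms(2)
proof (induction I rule: infinite_finite_induct)
  case (insert i I)
  then have "(deriv ^^ n) (\<lambda>t. u i t + (\<Sum>i\<in>I. u i t)) t = (deriv ^^ n) (u i) t + (deriv ^^ n) (\<lambda>t. \<Sum>i\<in>I. u i t) t"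
    by (intro higher_deriv_add[OF assms(1)] smooth_real_sum assms(1,3)) auto
  with insert show ?case by simp
qed (simp_all add: higher_deriv_zero)

text \<open>
  The case of the Leibniz rule in which one factor is linear. At \<open>t = b\<close> only the
  second term remains.
\<close>

lemma higher_deriv_linear_mult:
  assumes "open V" "smooth_real V u" "t \<in> V"
  shows "(deriv ^^ n) (\<lambda>t. (t - b) * u t) t = (t - b) * (deriv ^^ n) u t + n * (deriv ^^ (n - 1)) u t"
  using assms(3)
proof (induction n arbitrary: t)
  case (Suc n)
  have d: "((\<lambda>t. (t - b) * (deriv ^^ n) u t + n * (deriv ^^ (n - 1)) u t) has_real_derivative
      ((t - b) * (deriv ^^ Suc n) u t + Suc n * (deriv ^^ n) u t)) (at t)"
    using smooth_real_DERIV[OF assms(2) Suc.prems, of n] smooth_real_DERIV[OF assms(2) Suc.prems, of "n - 1"]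
    by (cases n) (auto intro!: derivative_eq_intros simp: algebra_simps)
  have e: "(deriv ^^ Suc n) (\<lambda>t. (t - b) * u t) t =
      deriv (\<lambda>t. (t - b) * (deriv ^^ n) u t + n * (deriv ^^ (n - 1)) u t) t"
    unfolding funpow.simps comp_apply by (rule deriv_cong_open[OF assms(1) _ Suc.prems]) (rule Suc.IH)
  show ?case unfolding e DERIV_imp_deriv[OF d] by simp
qed simp

text \<open>
  The value at \<open>b\<close> is the limit, so that the quotient stays smooth there.
\<close>

definition difference_quotient :: "real \<Rightarrow> (real \<Rightarrow> real) \<Rightarrow> real \<Rightarrow> real" where
  "difference_quotient b u t = (if t = b then deriv u b else (u t - u b) / (t - b))"

lemma difference_quotient: "u t = u b + (t - b) * difference_quotient b u t"
  by (simp add: difference_quotient_def)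

text \<open>
  Hadamard's lemma: the quotient equals \<open>\<integral>\<^sub>0\<^sup>1 u'(b + s (t - b))
  ds\<close>, which may be differentiated under the integral sign. Convexity keeps the segment from
  \<open>b\<close> to \<open>t\<close> inside the domain.
\<close>

lemma smooth_real_difference_quotient:
  assumes V: "open V" "convex V" "b \<in> V" and u: "smooth_real V u"
  shows "smooth_real V (difference_quotient b u)"
proof -
  \<comment> \<open>\<open>Q n\<close> is the \<open>n\<close>-th derivative of the quotient, by differentiation under the integral sign.\<close>
  define Q where "Q n t = integral (cbox 0 1) (\<lambda>s. s ^ n * (deriv ^^ Suc n) u (b + s * (t - b)))" for n t
  have seg: "b + s * (t - b) \<in> V" if "t \<in> V" "s \<in> cbox 0 1" for s t
  proof -
    have "(1 - s) *\<^sub>R b + s *\<^sub>R t \<in> V"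
      using that V by (intro convexD) auto
    then show ?thesis by (simp add: algebra_simps)
  qed
  have cont: "continuous_on V ((deriv ^^ n) u)" for n
    by (intro smooth_real_continuous_on smooth_real_higher_deriv u)
  have cont2: "continuous_on (V \<times> cbox 0 1) (\<lambda>p. (deriv ^^ n) u (b + snd p * (fst p - b)))" for n
    by (rule continuous_on_compose2[OF cont]) (auto intro!: continuous_intros seg)
  have cont1: "continuous_on (cbox 0 1) (\<lambda>s. (deriv ^^ n) u (b + s * (t - b)))" if "t \<in> V" for n t
    by (rule continuous_on_compose2[OF cont]) (auto intro!: continuous_intros seg that)
  have Q: "DERIV (Q n) t :> Q (Suc n) t" if t: "t \<in> V" for n t
  proof -
    have "(Q n has_real_derivative Q (Suc n) t) (at t within V)"
      unfolding Q_def
    proof (rule leibniz_rule_field_derivative[OF _ _ _ t V(2)])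
      fix x s :: real assume xs: "x \<in> V" "s \<in> cbox 0 1"
      have "((\<lambda>x. (deriv ^^ Suc n) u (b + s * (x - b))) has_real_derivative
          (deriv ^^ Suc (Suc n)) u (b + s * (x - b)) * s) (at x)"
      proof (rule DERIV_chain2[where f = "(deriv ^^ Suc n) u" and g = "\<lambda>x. b + s * (x - b)"])
        show "((\<lambda>x. b + s * (x - b)) has_real_derivative s) (at x)"
          by (auto intro!: derivative_eq_intros)
      qed (rule smooth_real_DERIV[OF u seg[OF xs]])
      from DERIV_cmult[OF this, of "s ^ n"]
      show "((\<lambda>x. s ^ n * (deriv ^^ Suc n) u (b + s * (x - b))) has_real_derivative
          s ^ Suc n * (deriv ^^ Suc (Suc n)) u (b + s * (x - b))) (at x within V)"
        by (simp add: mult_ac has_field_derivative_at_within)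
    next
      fix x assume "x \<in> V"
      then show "(\<lambda>s. s ^ n * (deriv ^^ Suc n) u (b + s * (x - b))) integrable_on cbox 0 1"
        by (intro integrable_continuous continuous_intros cont1)
    next
      show "continuous_on (V \<times> cbox 0 1)
          (\<lambda>(x, s). s ^ Suc n * (deriv ^^ Suc (Suc n)) u (b + s * (x - b)))"
        unfolding case_prod_beta by (intro continuous_intros cont2)
    qed
    then show ?thesis by (simp add: at_within_open[OF t V(1)])
  qed
  have "times_differentiable m V (Q n)" for m n
  proof (induction m arbitrary: n)
    case (Suc m)
    show ?case by (rule times_differentiable_SucI[OF V(1), where u' = "Q (Suc n)"]) (simp_all add: Q Suc)
  qed simp
  then have "smooth_real V (Q 0)" by (simp add: smooth_real_def)
  moreover have "difference_quotient b u t = Q 0 t" if t: "t \<in> V" for t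
  proof -
    have "((\<lambda>s. deriv u (b + s * (t - b)) * (t - b)) has_integral u (b + 1 * (t - b)) - u (b + 0 * (t - b))) {0..1}"
    proof (rule fundamental_theorem_of_calculus)
      fix s :: real assume s: "s \<in> {0..1}"
      have "((\<lambda>s. u (b + s * (t - b))) has_real_derivative deriv u (b + s * (t - b)) * (t - b)) (at s)"
      proof (rule DERIV_chain2[where f = u and g = "\<lambda>s. b + s * (t - b)"])
        show "(u has_real_derivative deriv u (b + s * (t - b))) (at (b + s * (t - b)))"
          using smooth_real_DERIV[OF u seg[OF t, of s], of 0] s by simp
        show "((\<lambda>s. b + s * (t - b)) has_real_derivative (t - b)) (at s)"
          by (auto intro!: derivative_eq_intros)
      qed
      then show "((\<lambda>s. u (b + s * (t - b))) has_vector_derivative deriv u (b + s * (t - b)) * (t - b))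
          (at s within {0..1})"
        by (simp add: has_real_derivative_iff_has_vector_derivative has_vector_derivative_at_within)
    qed simp
    from integral_unique[OF this] have "Q 0 t * (t - b) = u t - u b"
      by (simp add: Q_def)
    moreover have "Q 0 b = deriv u b"
      by (simp add: Q_def)
    ultimately show ?thesis
      by (auto simp: difference_quotient_def divide_eq_eq)
  qed
  ultimately show ?thesis by (rule smooth_real_cong[OF V(1), rotated])
qed

section \<open>Parity and body of a Grassmann number\<close>

lemma coeff_sum: "coeff (\<Sum>i\<in>I. x i) A = (\<Sum>i\<in>I. coeff (x i) A)"
  by (induction I rule: infinite_finite_induct) (simp_all add: coeff_simps)

lemma coeff_sign_mult: "coeff ((- 1) ^ k * x) A = (- 1) ^ k * coeff x A"
  by (simp add: minus_one_power_iff coeff_simps)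

lemma graded_partI: "(\<And>A. (even (fcard A) \<longleftrightarrow> even i) \<or> coeff x A = 0) \<Longrightarrow> x \<in> graded_part i"
  by (auto simp: graded_part_def)

lemma graded_part_0 [simp]: "0 \<in> graded_part i"
  by (simp add: graded_part_def coeff_simps)

lemma graded_part_of_real [simp]: "of_real r \<in> graded_part 0"
  by (auto simp: graded_part_def coeff_of_real fcard.rep_eq)

lemma graded_part_1 [simp]: "1 \<in> graded_part 0"
  using graded_part_of_real[of 1] by simp

lemma graded_part_add [intro]: "x \<in> graded_part i \<Longrightarrow> y \<in> graded_part i \<Longrightarrow> x + y \<in> graded_part i"
  unfolding graded_part_def coeff_simps mem_Collect_eq by (metis add.right_neutral)

lemma graded_part_diff [intro]: "x \<in> graded_part i \<Longrightarrow> y \<in> graded_part i \<Longrightarrow> x - y \<in> graded_part i"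
  unfolding graded_part_def coeff_simps mem_Collect_eq by (metis diff_zero)

lemma graded_part_uminus [intro]: "x \<in> graded_part i \<Longrightarrow> - x \<in> graded_part i"
  by (simp add: graded_part_def coeff_simps)

lemma graded_part_scaleR [intro]: "x \<in> graded_part i \<Longrightarrow> r *\<^sub>R x \<in> graded_part i"
  by (simp add: graded_part_def coeff_simps)

lemma graded_part_sum: "(\<And>k. k \<in> K \<Longrightarrow> x k \<in> graded_part i) \<Longrightarrow> (\<Sum>k\<in>K. x k) \<in> graded_part i"
  by (induction K rule: infinite_finite_induct) auto

lemma fcard_fminus: "A |\<subseteq>| C \<Longrightarrow> fcard C = fcard A + fcard (C |-| A)"
  by (simp add: fcard_funion_fsubset fcard_mono)

lemma fminus_fminus: "A |\<subseteq>| C \<Longrightarrow> C |-| (C |-| A) = A"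
  by auto

lemma graded_part_mult:
  assumes "x \<in> graded_part i" "y \<in> graded_part j"
  shows "x * y \<in> graded_part (i + j)"
proof (rule graded_partI)
  fix C
  have "coeff (x * y) C = 0" if "even (fcard C) \<noteq> even (i + j)"
    unfolding coeff_times
  proof (rule sum.neutral, rule ballI)
    fix A assume "A \<in> {A. A |\<subseteq>| C}"
    then have "fcard C = fcard A + fcard (C |-| A)" by (simp add: fcard_fminus)
    with that have "even (fcard A) \<noteq> even i \<or> even (fcard (C |-| A)) \<noteq> even j" by auto
    with assms have "coeff x A = 0 \<or> coeff y (C |-| A) = 0" by (auto simp: graded_part_def)
    then show "shuffle_sign A (C |-| A) * coeff x A * coeff y (C |-| A) = 0" by auto
  qed
  then show "(even (fcard C) \<longleftrightarrow> even (i + j)) \<or> coeff (x * y) C = 0" by blast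
qed

lemma graded_part_mult_even [intro]:
  "x \<in> graded_part i \<Longrightarrow> y \<in> graded_part 0 \<Longrightarrow> x * y \<in> graded_part i"
  "x \<in> graded_part 0 \<Longrightarrow> y \<in> graded_part i \<Longrightarrow> x * y \<in> graded_part i"
  using graded_part_mult[of x i y 0] graded_part_mult[of x 0 y i] by simp_all

lemma graded_part_power [intro]: "x \<in> graded_part 0 \<Longrightarrow> x ^ n \<in> graded_part 0"
  by (induction n) auto

text \<open>
  For disjoint sets every pair in \<open>A \<times> B\<close> is an inversion of exactly one of the
  two concatenations.
\<close>

lemma shuffle_sign_swap:
  assumes "A |\<inter>| B = {||}"
  shows "shuffle_sign A B = (- 1) ^ (fcard A * fcard B) * shuffle_sign B A"
proof -
  have "inversions A B \<union> prod.swap ` inversions B A = fset A \<times> fset B"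
  proof (intro equalityI subsetI)
    fix p assume "p \<in> fset A \<times> fset B"
    then obtain a b where p: "p = (a, b)" "a |\<in>| A" "b |\<in>| B" by auto
    with assms have "a \<noteq> b" by auto
    then consider "b < a" | "a < b" by linarith
    then show "p \<in> inversions A B \<union> prod.swap ` inversions B A"
    proof cases
      case 2
      with p have "(b, a) \<in> inversions B A" by (simp add: inversions_def)
      with p show ?thesis by force
    qed (use p in \<open>simp add: inversions_def\<close>)
  qed (auto simp: inversions_def)
  moreover have "inversions A B \<inter> prod.swap ` inversions B A = {}"
    by (auto simp: inversions_def)
  moreover have "card (prod.swap ` inversions B A) = card (inversions B A)"
    by (simp add: card_image)
  ultimately have "card (inversions A B) + card (inversions B A) = fcard A * fcard B"
    using card_Un_disjoint[of "inversions A B" "prod.swap ` inversions B A"]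
    by (simp add: card_cartesian_product fcard.rep_eq)
  then have "even (fcard A * fcard B) \<longleftrightarrow> (even (card (inversions A B)) \<longleftrightarrow> even (card (inversions B A)))"
    by (metis even_add)
  then show ?thesis
    unfolding shuffle_sign_def minus_one_power_iff by auto
qed

lemma graded_commute:
  assumes a: "a \<in> graded_part i" and b: "b \<in> graded_part j"
  shows "a * b = (- 1) ^ (i * j) * (b * a)"
proof (rule grassmann_eqI)
  fix C
  have flip: "coeff (b * a) C = (\<Sum>A | A |\<subseteq>| C. shuffle_sign (C |-| A) A * coeff b (C |-| A) * coeff a A)"
    unfolding coeff_times
    by (rule sum.reindex_bij_witness[where i = "\<lambda>A. C |-| A" and j = "\<lambda>A. C |-| A"])
       (auto simp: fminus_fminus)
  have swap: "shuffle_sign A (C |-| A) * coeff a A * coeff b (C |-| A) =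
      (- 1) ^ (i * j) * (shuffle_sign (C |-| A) A * coeff b (C |-| A) * coeff a A)" for A
  proof (cases "coeff a A = 0 \<or> coeff b (C |-| A) = 0")
    case False
    with a b have "even (fcard A) = even i" "even (fcard (C |-| A)) = even j"
      by (auto simp: graded_part_def)
    then have "(- 1 :: real) ^ (fcard A * fcard (C |-| A)) = (- 1) ^ (i * j)"
      by (simp add: minus_one_power_iff)
    moreover have "A |\<inter>| (C |-| A) = {||}" by auto
    ultimately show ?thesis using shuffle_sign_swap[of A "C |-| A"] by (simp add: mult_ac)
  qed auto
  show "coeff (a * b) C = coeff ((- 1) ^ (i * j) * (b * a)) C"
    unfolding coeff_sign_mult flip sum_distrib_left coeff_times[of a b]
    by (rule sum.cong) (simp_all only: swap)
qed

definition homogeneous_part :: "nat \<Rightarrow> grassmann \<Rightarrow> grassmann" where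
  "homogeneous_part i x = Grassmann (\<lambda>A. if even (fcard A) \<longleftrightarrow> even i then coeff x A else 0)"

lemma homogeneous_part [simp]: "homogeneous_part i x \<in> graded_part i"
  by (auto simp: homogeneous_part_def graded_part_def)

lemma homogeneous_decomposition: "homogeneous_part 0 x + homogeneous_part 1 x = x"
  by (rule grassmann_eqI) (simp add: homogeneous_part_def coeff_simps)

lemma even_commute:
  assumes "a \<in> graded_part 0"
  shows "a * b = b * a"
proof -
  have "a * homogeneous_part i b = homogeneous_part i b * a" for i
    using graded_commute[OF assms homogeneous_part, of i b] by simp
  then have "a * (homogeneous_part 0 b + homogeneous_part 1 b) = (homogeneous_part 0 b + homogeneous_part 1 b) * a"
    by (simp add: distrib_left distrib_right)
  then show ?thesis by (simp only: homogeneous_decomposition)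
qed

lemma body_add [simp]: "body (x + y) = body x + body y"
  and body_diff [simp]: "body (x - y) = body x - body y"
  and body_uminus [simp]: "body (- x) = - body x"
  and body_of_real [simp]: "body (of_real r) = r"
  by (simp_all add: body_def coeff_simps coeff_of_real)

lemma body_1 [simp]: "body 1 = 1"
  using body_of_real[of 1] by simp

lemma body_mult [simp]: "body (x * y) = body x * body y"
proof -
  have "{A :: nat fset. A |\<subseteq>| {||}} = {{||}}" by auto
  then show ?thesis by (simp add: body_def coeff_times)
qed

lemma body_power [simp]: "body (x ^ n) = body x ^ n"
  by (induction n) simp_all

lemma body_soul [simp]: "body (soul x) = 0"
  by (simp add: soul_def)

lemma soul_of_real [simp]: "soul (of_real r) = 0"
  by (simp add: soul_def)

lemma even_soul [simp]: "x \<in> graded_part 0 \<Longrightarrow> soul x \<in> graded_part 0"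
  by (auto simp: soul_def)

text \<open>
  An error term that always equals another error term of the same kind times the soul is divisible
  by all powers of the soul. Powers of the soul have no coefficients of small degree, so the error
  vanishes. This replaces estimates of remainders.
\<close>

lemma soul_descent:
  fixes err :: "'b \<Rightarrow> grassmann"
  assumes step: "\<And>f. f \<in> S \<Longrightarrow> \<exists>g\<in>S. err f = err g * soul x" and f: "f \<in> S"
  shows "err f = 0"
proof (rule grassmann_eqI)
  fix A :: "nat fset"
  have "\<exists>g\<in>S. err f = err g * soul x ^ n" for n
  proof (induction n)
    case (Suc n)
    then obtain g where "g \<in> S" "err f = err g * soul x ^ n" by blast
    with step[of g] show ?case by (metis mult.assoc power_Suc)
  qed (use f in auto)
  then obtain g where "err f = err g * soul x ^ Suc (fcard A)" by blast
  then show "coeff (err f) A = coeff 0 A"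
    by (simp only: coeff_mult_soul_power_eq_0[OF lessI] coeff_simps)
qed

text \<open>
  Lets a formal sum inside a product be replaced by a truncation of it.
\<close>

lemma coeff_mult_cong:
  assumes "\<And>B. B |\<subseteq>| A \<Longrightarrow> coeff x B = coeff x' B" "\<And>B. B |\<subseteq>| A \<Longrightarrow> coeff y B = coeff y' B"
  shows "coeff (x * y) A = coeff (x' * y') A"
  unfolding coeff_times by (rule sum.cong) (use assms in \<open>auto simp: fminus_fsubset\<close>)

section \<open>The algebra of Grassmann extensions\<close>

lemma smooth_on_iff: "smooth_on V f \<longleftrightarrow> (\<forall>A. smooth_real V (\<lambda>t. coeff (f t) A))"
  by (auto simp: smooth_on_def smooth_real_iff)

lemma smooth_on_const: "smooth_on V (\<lambda>_. a)"
  by (simp add: smooth_on_iff smooth_real_const)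

lemma smooth_on_subset: "smooth_on V f \<Longrightarrow> W \<subseteq> V \<Longrightarrow> smooth_on W f"
  by (auto simp: smooth_on_def)

lemma smooth_on_cong:
  assumes "open V" "\<And>t. t \<in> V \<Longrightarrow> f t = g t" "smooth_on V g"
  shows "smooth_on V f"
  unfolding smooth_on_iff
proof
  fix A show "smooth_real V (\<lambda>t. coeff (f t) A)"
    by (rule smooth_real_cong[OF assms(1), where v = "\<lambda>t. coeff (g t) A"])
       (use assms(2,3) in \<open>simp_all add: smooth_on_iff\<close>)
qed

lemma smooth_on_add: "open V \<Longrightarrow> smooth_on V f \<Longrightarrow> smooth_on V g \<Longrightarrow> smooth_on V (\<lambda>t. f t + g t)"
  by (simp add: smooth_on_iff coeff_simps smooth_real_add)

lemma smooth_on_mult: "open V \<Longrightarrow> smooth_on V f \<Longrightarrow> smooth_on V g \<Longrightarrow> smooth_on V (\<lambda>t. f t * g t)"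
  unfolding smooth_on_iff coeff_times
  by (intro allI smooth_real_sum smooth_real_mult smooth_real_const) auto

lemma smooth_on_of_real: "smooth_real V u \<Longrightarrow> smooth_on V (\<lambda>t. of_real (u t))"
  unfolding smooth_on_iff
proof
  fix A assume "smooth_real V u"
  then show "smooth_real V (\<lambda>t. coeff (of_real (u t)) A)"
    by (cases "A = {||}") (simp_all add: coeff_of_real smooth_real_const)
qed

lemma smooth_on_compose:
  assumes "open V" "\<And>t. t \<in> V \<Longrightarrow> p t \<in> W" "smooth_on W f" "smooth_real V p"
  shows "smooth_on V (\<lambda>t. f (p t))"
  unfolding smooth_on_iff
proof
  fix A show "smooth_real V (\<lambda>t. coeff (f (p t)) A)"
    by (rule smooth_real_compose[OF assms(1,2) _ assms(4)]) (use assms(3) in \<open>simp_all add: smooth_on_iff\<close>)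
qed

lemma coeff_nth_deriv: "coeff (nth_deriv n f t) A = (deriv ^^ n) (\<lambda>s. coeff (f s) A) t"
  by (simp add: nth_deriv_def)

lemma nth_deriv_0 [simp]: "nth_deriv 0 f = f"
  by (simp add: nth_deriv_def fun_eq_iff)

lemma smooth_on_nth_deriv: "smooth_on V f \<Longrightarrow> smooth_on V (nth_deriv n f)"
  unfolding smooth_on_iff coeff_nth_deriv by (auto intro: smooth_real_higher_deriv)

lemma nth_deriv_cong_open:
  assumes "open V" "\<And>t. t \<in> V \<Longrightarrow> f t = g t" "t \<in> V"
  shows "nth_deriv n f t = nth_deriv n g t"
  by (rule grassmann_eqI, unfold coeff_nth_deriv, rule higher_deriv_cong_open[OF assms(1) _ assms(3)])
     (simp add: assms(2))

lemma nth_deriv_const [simp]: "nth_deriv (Suc n) (\<lambda>_. a) = (\<lambda>_. 0)"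
  by (rule ext, rule grassmann_eqI)
     (simp add: coeff_nth_deriv coeff_simps higher_deriv_zero funpow_Suc_right del: funpow.simps)

lemma nth_deriv_add:
  assumes "open V" "smooth_on V f" "smooth_on V g" "t \<in> V"
  shows "nth_deriv n (\<lambda>t. f t + g t) t = nth_deriv n f t + nth_deriv n g t"
  using assms by (intro grassmann_eqI) (simp add: coeff_nth_deriv coeff_simps smooth_on_iff higher_deriv_add[of V])

lemma nth_deriv_cmult:
  assumes "open V" "smooth_on V f" "t \<in> V"
  shows "nth_deriv n (\<lambda>t. a * f t) t = a * nth_deriv n f t"
proof (rule grassmann_eqI)
  fix C
  have "smooth_real V (\<lambda>t. coeff (f t) A)" for A
    using assms by (simp add: smooth_on_iff)
  then show "coeff (nth_deriv n (\<lambda>t. a * f t) t) C = coeff (a * nth_deriv n f t) C"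
    unfolding coeff_nth_deriv coeff_times
    by (subst higher_deriv_sum[OF assms(1) _ assms(3)])
       (auto intro!: smooth_real_mult smooth_real_const sum.cong
         simp: coeff_nth_deriv higher_deriv_cmult[OF assms(1) _ assms(3)] assms(1))
qed

lemma nth_deriv_linear_mult:
  assumes "open V" "smooth_on V f" "t \<in> V"
  shows "nth_deriv n (\<lambda>t. (t - b) *\<^sub>R f t) t = (t - b) *\<^sub>R nth_deriv n f t + real n *\<^sub>R nth_deriv (n - 1) f t"
  using assms
  by (intro grassmann_eqI) (simp add: coeff_nth_deriv coeff_simps smooth_on_iff higher_deriv_linear_mult[of V])

lemma nth_deriv_1_mult:
  assumes "open V" "smooth_on V f" "smooth_on V g" "t \<in> V"
  shows "nth_deriv 1 (\<lambda>t. f t * g t) t = nth_deriv 1 f t * g t + f t * nth_deriv 1 g t"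
proof (rule grassmann_eqI)
  fix C
  have D: "((\<lambda>t. coeff (h t) A) has_real_derivative coeff (nth_deriv 1 h t) A) (at t)" if "smooth_on V h" for h A
    using smooth_real_DERIV[of V "\<lambda>t. coeff (h t) A" t 0] that assms by (simp add: smooth_on_iff coeff_nth_deriv)
  have "((\<lambda>t. coeff (f t * g t) C) has_real_derivative
      (\<Sum>A | A |\<subseteq>| C. shuffle_sign A (C |-| A) * coeff (nth_deriv 1 f t) A * coeff (g t) (C |-| A) +
        shuffle_sign A (C |-| A) * coeff (f t) A * coeff (nth_deriv 1 g t) (C |-| A))) (at t)"
    unfolding coeff_times
    by (rule DERIV_sum) (auto intro!: derivative_eq_intros D[OF assms(2)] D[OF assms(3)])
  from DERIV_imp_deriv[OF this]
  show "coeff (nth_deriv 1 (\<lambda>t. f t * g t) t) C = coeff (nth_deriv 1 f t * g t + f t * nth_deriv 1 g t) C"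
    by (simp add: coeff_nth_deriv coeff_simps coeff_times sum.distrib)
qed

lemma nth_deriv_graded:
  assumes "open V" "\<And>t. t \<in> V \<Longrightarrow> f t \<in> graded_part i" "t \<in> V"
  shows "nth_deriv n f t \<in> graded_part i"
proof (rule graded_partI)
  fix A
  have "coeff (nth_deriv n f t) A = 0" if "even (fcard A) \<noteq> even i"
  proof -
    have "(deriv ^^ n) (\<lambda>s. coeff (f s) A) t = (deriv ^^ n) (\<lambda>_. 0) t"
      using assms(2) that by (intro higher_deriv_cong_open[OF assms(1) _ assms(3)]) (auto simp: graded_part_def)
    then show ?thesis by (simp add: coeff_nth_deriv higher_deriv_zero)
  qed
  then show "(even (fcard A) \<longleftrightarrow> even i) \<or> coeff (nth_deriv n f t) A = 0" by blast
qed

text \<open>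
  The factor in the first-order expansion \<open>f t = f b + (t - b) g t\<close>, coefficient by
  coefficient.
\<close>

definition slope :: "real \<Rightarrow> (real \<Rightarrow> grassmann) \<Rightarrow> real \<Rightarrow> grassmann" where
  "slope b f t = Grassmann (\<lambda>A. difference_quotient b (\<lambda>s. coeff (f s) A) t)"

lemma slope: "f t = f b + (t - b) *\<^sub>R slope b f t"
  by (rule grassmann_eqI)
     (simp add: coeff_simps slope_def difference_quotient[of "\<lambda>s. coeff (f s) A" t b for A, symmetric])

lemma smooth_on_slope: "open V \<Longrightarrow> convex V \<Longrightarrow> b \<in> V \<Longrightarrow> smooth_on V f \<Longrightarrow> smooth_on V (slope b f)"
  by (simp add: smooth_on_iff slope_def smooth_real_difference_quotient)

lemma slope_graded:
  assumes "open V" "b \<in> V" "\<And>t. t \<in> V \<Longrightarrow> f t \<in> graded_part i" "t \<in> V"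
  shows "slope b f t \<in> graded_part i"
proof (rule graded_partI)
  fix A
  have "coeff (slope b f t) A = 0" if A: "even (fcard A) \<noteq> even i"
  proof -
    have z: "coeff (f s) A = 0" if "s \<in> V" for s
      using assms(3)[OF that] A by (auto simp: graded_part_def)
    have "deriv (\<lambda>s. coeff (f s) A) b = deriv (\<lambda>_. 0) b"
      by (rule deriv_cong_open[OF assms(1) z assms(2)])
    then show ?thesis
      using z assms(2,4) by (simp add: slope_def difference_quotient_def)
  qed
  then show "(even (fcard A) \<longleftrightarrow> even i) \<or> coeff (slope b f t) A = 0" by blast
qed

definition taylor_sum :: "nat \<Rightarrow> (real \<Rightarrow> grassmann) \<Rightarrow> grassmann \<Rightarrow> grassmann" where
  "taylor_sum N f x = (\<Sum>n<N. (1 / fact n) *\<^sub>R nth_deriv n f (body x) * soul x ^ n)"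

text \<open>
  A coefficient of degree below \<open>N\<close> sees only the first \<open>N\<close> terms of the
  series, so identities between extensions reduce to identities between finite sums.
\<close>

lemma coeff_G_extension:
  assumes "fcard A < N"
  shows "coeff (G_extension f x) A = coeff (taylor_sum N f x) A"
proof -
  have "(\<Sum>n. coeff ((1 / fact n) *\<^sub>R nth_deriv n f (body x) * soul x ^ n) A) =
      (\<Sum>n<N. coeff ((1 / fact n) *\<^sub>R nth_deriv n f (body x) * soul x ^ n) A)"
    by (rule suminf_finite) (use assms in \<open>auto intro!: coeff_mult_soul_power_eq_0 simp del: mult_scaleR_left\<close>)
  then show ?thesis by (simp add: G_extension_def taylor_sum_def coeff_sum)
qed

lemma G_extension_cong:
  assumes "open V" "body x \<in> V" "\<And>t. t \<in> V \<Longrightarrow> f t = g t"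
  shows "G_extension f x = G_extension g x"
proof -
  have "nth_deriv n f (body x) = nth_deriv n g (body x)" for n
    by (rule nth_deriv_cong_open[OF assms(1,3,2)])
  then show ?thesis by (simp add: G_extension_def)
qed

lemma G_extension_add:
  assumes "open V" "body x \<in> V" "smooth_on V f" "smooth_on V g"
  shows "G_extension (\<lambda>t. f t + g t) x = G_extension f x + G_extension g x"
proof (rule grassmann_eqI)
  fix A
  have "taylor_sum N (\<lambda>t. f t + g t) x = taylor_sum N f x + taylor_sum N g x" for N
    by (simp add: taylor_sum_def nth_deriv_add[OF assms(1,3,4,2)] sum.distrib algebra_simps)
  then show "coeff (G_extension (\<lambda>t. f t + g t) x) A = coeff (G_extension f x + G_extension g x) A"
    by (simp add: coeff_G_extension[OF lessI] coeff_simps)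
qed

lemma G_extension_cmult:
  assumes "open V" "body x \<in> V" "smooth_on V f"
  shows "G_extension (\<lambda>t. a * f t) x = a * G_extension f x"
proof (rule grassmann_eqI)
  fix A :: "nat fset"
  let ?N = "Suc (fcard A)"
  have "taylor_sum N (\<lambda>t. a * f t) x = a * taylor_sum N f x" for N
    by (simp add: taylor_sum_def nth_deriv_cmult[OF assms(1,3,2)] sum_distrib_left mult.assoc)
  moreover have "coeff (a * taylor_sum ?N f x) A = coeff (a * G_extension f x) A"
    by (intro coeff_mult_cong coeff_G_extension[symmetric]) (auto simp: less_Suc_eq_le fcard_mono)
  ultimately show "coeff (G_extension (\<lambda>t. a * f t) x) A = coeff (a * G_extension f x) A"
    by (simp add: coeff_G_extension[OF lessI])
qed

lemma G_extension_const [simp]: "G_extension (\<lambda>_. a) x = a"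
proof (rule grassmann_eqI)
  fix A :: "nat fset"
  have "taylor_sum (Suc (fcard A)) (\<lambda>_. a) x = a"
    unfolding taylor_sum_def sum.lessThan_Suc_shift by simp
  then show "coeff (G_extension (\<lambda>_. a) x) A = coeff a A"
    by (simp add: coeff_G_extension[OF lessI])
qed

text \<open>
  Multiplying a function by \<open>t - b\<close> shifts its normalised Taylor coefficients at \<open>b\<close> by one place.
\<close>

lemma G_extension_linear_mult:
  assumes "open V" "body x \<in> V" "smooth_on V f"
  shows "G_extension (\<lambda>t. (t - body x) *\<^sub>R f t) x = G_extension f x * soul x"
proof (rule grassmann_eqI)
  fix A :: "nat fset"
  let ?N = "Suc (fcard A)" and ?b = "body x"
  have D: "nth_deriv n (\<lambda>t. (t - ?b) *\<^sub>R f t) ?b = real n *\<^sub>R nth_deriv (n - 1) f ?b" for n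
    using nth_deriv_linear_mult[OF assms(1,3,2), of n ?b] by simp
  have "(1 / fact (Suc n)) *\<^sub>R nth_deriv (Suc n) (\<lambda>t. (t - ?b) *\<^sub>R f t) ?b * soul x ^ Suc n =
      (1 / fact n) *\<^sub>R nth_deriv n f ?b * soul x ^ n * soul x" for n
    unfolding D power_Suc2 by (simp add: mult.assoc divide_simps del: power_Suc of_nat_Suc)
  then have "taylor_sum (Suc N) (\<lambda>t. (t - ?b) *\<^sub>R f t) x = taylor_sum N f x * soul x" for N
    unfolding taylor_sum_def sum.lessThan_Suc_shift[of _ N] by (simp add: sum_distrib_right D)
  moreover have "coeff (taylor_sum ?N f x * soul x) A = coeff (G_extension f x * soul x) A"
    by (intro coeff_mult_cong coeff_G_extension[symmetric]) (auto simp: less_Suc_eq_le fcard_mono)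
  ultimately show "coeff (G_extension (\<lambda>t. (t - ?b) *\<^sub>R f t) x) A = coeff (G_extension f x * soul x) A"
    by (simp add: coeff_G_extension[of A "Suc ?N"])
qed

lemma smooth_on_linear_mult: "open V \<Longrightarrow> smooth_on V f \<Longrightarrow> smooth_on V (\<lambda>t. (t - b) *\<^sub>R f t)"
  unfolding scaleR_conv_of_real diff_conv_add_uminus
  by (intro smooth_on_mult smooth_on_of_real smooth_real_add smooth_real_id smooth_real_const)

lemma G_extension_of_real [simp]: "G_extension of_real x = x"
proof -
  have "G_extension of_real x = G_extension (\<lambda>t. of_real (body x) + (t - body x) *\<^sub>R 1) x"
    by (rule G_extension_cong[of UNIV]) (simp_all add: of_real_def algebra_simps)
  also have "\<dots> = of_real (body x) + 1 * soul x"
    by (simp only: G_extension_const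
        G_extension_add[OF open_UNIV UNIV_I smooth_on_const smooth_on_linear_mult[OF open_UNIV smooth_on_const]]
        G_extension_linear_mult[OF open_UNIV UNIV_I smooth_on_const])
  finally show ?thesis by (simp add: soul_def)
qed

text \<open>
  Hadamard's lemma after extension. Every descent below starts from this expansion.
\<close>

lemma G_extension_slope:
  assumes "open V" "convex V" "body x \<in> V" "smooth_on V f"
  shows "G_extension f x = f (body x) + G_extension (slope (body x) f) x * soul x"
proof -
  note sm = smooth_on_slope[OF assms(1-4)]
  have "G_extension f x = G_extension (\<lambda>t. f (body x) + (t - body x) *\<^sub>R slope (body x) f t) x"
    by (rule G_extension_cong[of UNIV]) (auto intro: slope)
  also have "\<dots> = f (body x) + G_extension (slope (body x) f) x * soul x"
    by (subst G_extension_add[OF assms(1,3) smooth_on_const smooth_on_linear_mult[OF assms(1) sm]])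
       (simp add: G_extension_linear_mult[OF assms(1,3) sm])
  finally show ?thesis .
qed

lemma open_contains_interval:
  assumes "open V" "b \<in> (V :: real set)"
  obtains B where "open B" "convex B" "b \<in> B" "B \<subseteq> V"
  using assms by (metis centre_in_ball convex_ball open_ball open_contains_ball)

lemma body_G_extension:
  assumes "open V" "body x \<in> V" "smooth_on V f"
  shows "body (G_extension f x) = body (f (body x))"
proof -
  obtain B where "open B" "convex B" "body x \<in> B" "B \<subseteq> V"
    using open_contains_interval assms(1,2) by blast
  with assms(3) show ?thesis
    by (subst G_extension_slope[of B]) (auto intro: smooth_on_subset)
qed

lemma G_extension_at_real:
  assumes "open V" "r \<in> V" "smooth_on V f"
  shows "G_extension f (of_real r) = f r"
proof -
  obtain B where "open B" "convex B" "r \<in> B" "B \<subseteq> V"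
    using open_contains_interval assms(1,2) by blast
  with assms(3) show ?thesis
    by (subst G_extension_slope[of B]) (auto intro: smooth_on_subset)
qed

lemma G_extension_graded:
  assumes "open V" "body x \<in> V" "x \<in> graded_part 0" "\<And>t. t \<in> V \<Longrightarrow> f t \<in> graded_part i"
  shows "G_extension f x \<in> graded_part i"
proof (rule graded_partI)
  fix A :: "nat fset"
  have "taylor_sum N f x \<in> graded_part i" for N
    unfolding taylor_sum_def using assms
    by (intro graded_part_sum graded_part_mult_even(1) graded_part_scaleR graded_part_power even_soul
        nth_deriv_graded[of V]) auto
  then show "(even (fcard A) \<longleftrightarrow> even i) \<or> coeff (G_extension f x) A = 0"
    unfolding coeff_G_extension[OF lessI] graded_part_def by blast
qed

text \<open>
  With \<open>h\<close> the slope of \<open>f\<close>, the defect of \<open>f\<close> is the defect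
  of \<open>h\<close> times the soul; \<open>g\<close> stays fixed. The argument must be even, so
  that its soul can be moved past the extension of \<open>g\<close>.
\<close>

lemma G_extension_mult:
  assumes V: "open V" "body x \<in> V" and x: "x \<in> graded_part 0" and f: "smooth_on V f" and g: "smooth_on V g"
  shows "G_extension (\<lambda>t. f t * g t) x = G_extension f x * G_extension g x"
proof -
  obtain B where B: "open B" "convex B" "body x \<in> B" "B \<subseteq> V"
    using open_contains_interval V by blast
  have g': "smooth_on B g" using g B(4) by (rule smooth_on_subset)
  let ?G = G_extension and ?b = "body x"
  have "?G (\<lambda>t. f t * g t) x - ?G f x * ?G g x = 0"
  proof (rule soul_descent[where S = "{f. smooth_on B f}" and x = x
        and err = "\<lambda>f. ?G (\<lambda>t. f t * g t) x - ?G f x * ?G g x"])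
    fix f assume "f \<in> {f. smooth_on B f}"
    then have f: "smooth_on B f" by simp
    let ?h = "slope ?b f"
    have h: "smooth_on B ?h" by (rule smooth_on_slope[OF B(1-3) f])
    have "f t * g t = f ?b * g t + (t - ?b) *\<^sub>R (?h t * g t)" for t
      by (subst slope[of f t ?b]) (simp add: distrib_right)
    then have "?G (\<lambda>t. f t * g t) x = ?G (\<lambda>t. f ?b * g t + (t - ?b) *\<^sub>R (?h t * g t)) x"
      by simp
    also have "\<dots> = f ?b * ?G g x + ?G (\<lambda>t. ?h t * g t) x * soul x"
      using B g' h
      by (simp add: G_extension_add[of B] smooth_on_mult smooth_on_const smooth_on_linear_mult
          G_extension_cmult[of B] G_extension_linear_mult[of B])
    finally have "?G (\<lambda>t. f t * g t) x - ?G f x * ?G g x =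
        (?G (\<lambda>t. ?h t * g t) x - ?G ?h x * ?G g x) * soul x"
      unfolding G_extension_slope[OF B(1-3) f]
      by (simp add: algebra_simps even_commute[OF even_soul[OF x], of "?G g x"])
    with h show "\<exists>h\<in>{f. smooth_on B f}. ?G (\<lambda>t. f t * g t) x - ?G f x * ?G g x =
        (?G (\<lambda>t. h t * g t) x - ?G h x * ?G g x) * soul x" by blast
  qed (use f B(4) in \<open>auto intro: smooth_on_subset\<close>)
  then show ?thesis by simp
qed

text \<open>
  With \<open>h\<close> the slope of \<open>f\<close> at \<open>p b\<close>, the defect of
  \<open>f\<close> is the defect of \<open>h\<close> times the soul of the extension of
  \<open>p\<close>. This avoids the formula for the higher derivatives of a composition.
\<close>

lemma G_extension_compose:
  assumes V: "open V" "body x \<in> V" and x: "x \<in> graded_part 0" and p: "smooth_real V p"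
    and W: "open W" "\<And>t. t \<in> V \<Longrightarrow> p t \<in> W" and f: "smooth_on W f"
  shows "G_extension (\<lambda>t. f (p t)) x = G_extension f (G_extension (\<lambda>t. of_real (p t)) x)"
proof -
  let ?G = G_extension and ?b = "body x" and ?y = "G_extension (\<lambda>t. of_real (p t)) x"
  have y: "body ?y = p ?b"
    using body_G_extension[OF V smooth_on_of_real[OF p]] by simp
  have "p ?b \<in> W" using V(2) W(2) by blast
  then obtain B where B: "open B" "convex B" "p ?b \<in> B" "B \<subseteq> W"
    using open_contains_interval W(1) by blast
  have V': "open (V \<inter> p -` B)"
    by (rule continuous_open_preimage[OF smooth_real_continuous_on[OF p] V(1) B(1)])
  let ?V = "V \<inter> p -` B"
  have p': "smooth_real ?V p" using p by (rule smooth_real_subset) auto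
  have b: "?b \<in> ?V" using V B by auto
  have comp: "smooth_on ?V (\<lambda>t. f (p t))" if "smooth_on B f" for f
    by (rule smooth_on_compose[OF V' _ that p']) auto
  have py: "?G (\<lambda>t. of_real (p t - p ?b)) x = soul ?y"
  proof -
    have "?G (\<lambda>t. of_real (p t) + - of_real (p ?b)) x = ?y + - of_real (p ?b)"
      by (subst G_extension_add[OF V smooth_on_of_real[OF p] smooth_on_const]) simp
    then show ?thesis by (simp add: soul_def y)
  qed
  have "?G (\<lambda>t. f (p t)) x - ?G f ?y = 0"
  proof (rule soul_descent[where S = "{f. smooth_on B f}" and x = ?y
        and err = "\<lambda>f. ?G (\<lambda>t. f (p t)) x - ?G f ?y"])
    fix f assume "f \<in> {f. smooth_on B f}"
    then have f: "smooth_on B f" by simp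
    let ?h = "slope (p ?b) f"
    have h: "smooth_on B ?h" by (rule smooth_on_slope[OF B(1-3) f])
    have pp: "smooth_on ?V (\<lambda>t. of_real (p t - p ?b))"
      unfolding diff_conv_add_uminus by (intro smooth_on_of_real smooth_real_add smooth_real_const p' V')
    have "f (p t) = f (p ?b) + ?h (p t) * of_real (p t - p ?b)" for t
      by (subst slope[of f "p t" "p ?b"])
         (simp add: scaleR_conv_of_real even_commute[OF graded_part_of_real, of _ "?h (p t)"] del: of_real_diff)
    then have "(\<lambda>t. f (p t)) = (\<lambda>t. f (p ?b) + ?h (p t) * of_real (p t - p ?b))" by (rule ext)
    then have "?G (\<lambda>t. f (p t)) x = ?G (\<lambda>t. f (p ?b) + ?h (p t) * of_real (p t - p ?b)) x"
      by (rule arg_cong)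
    also have "\<dots> = f (p ?b) + ?G (\<lambda>t. ?h (p t)) x * soul ?y"
      using pp by (simp add: G_extension_add[OF V' b] smooth_on_mult[OF V'] smooth_on_const comp[OF h]
          G_extension_mult[OF V' b x] py del: of_real_diff)
    finally have "?G (\<lambda>t. f (p t)) x - ?G f ?y = (?G (\<lambda>t. ?h (p t)) x - ?G ?h ?y) * soul ?y"
      using G_extension_slope[of B ?y f] B f y by (simp add: algebra_simps)
    with h show "\<exists>h\<in>{f. smooth_on B f}. ?G (\<lambda>t. f (p t)) x - ?G f ?y =
        (?G (\<lambda>t. h (p t)) x - ?G h ?y) * soul ?y" by blast
  qed (use f B(4) in \<open>auto intro: smooth_on_subset\<close>)
  then show ?thesis by simp
qed

text \<open>
  The square of the body is positive, so \<open>a\<^sup>2\<close> can be inverted by extending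
  \<open>t powr -1\<close> from the positive reals, and \<open>a\<close> times that inverse is the
  inverse of \<open>a\<close>.
\<close>

lemma even_inverse:
  assumes a: "a \<in> graded_part 0" and "body a \<noteq> 0"
  obtains b where "a * b = 1"
proof -
  have y: "a\<^sup>2 \<in> graded_part 0" "body (a\<^sup>2) \<in> {0<..}"
    using assms by auto
  have s: "smooth_on {0<..} (\<lambda>t. of_real (t powr - 1))" "smooth_on {0<..} of_real"
    by (intro smooth_on_of_real smooth_real_powr smooth_real_id)+
  have "a\<^sup>2 * G_extension (\<lambda>t. of_real (t powr - 1)) (a\<^sup>2) =
      G_extension (\<lambda>t. of_real t * of_real (t powr - 1)) (a\<^sup>2)"
    by (subst G_extension_mult[OF open_greaterThan y(2,1) s(2,1)]) simp
  also have "\<dots> = G_extension (\<lambda>_. 1) (a\<^sup>2)"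
    by (rule G_extension_cong[OF open_greaterThan y(2)]) (simp add: powr_minus flip: of_real_mult)
  finally have "a * (a * G_extension (\<lambda>t. of_real (t powr - 1)) (a\<^sup>2)) = 1"
    by (simp add: power2_eq_square mult.assoc)
  then show thesis by (rule that)
qed

lemma even_cancel:
  assumes "a \<in> graded_part 0" "body a \<noteq> 0" "x * a = y * a"
  shows "x = y"
proof -
  obtain b where "a * b = 1" using even_inverse assms(1,2) by blast
  moreover have "x * (a * b) = y * (a * b)" unfolding mult.assoc[symmetric] assms(3) ..
  ultimately show ?thesis by simp
qed

section \<open>The derivative of a G-infinity function\<close>

definition tube :: "real set \<Rightarrow> grassmann set" where
  "tube V = {x \<in> graded_part 0. body x \<in> V}"

lemma tube_iff [simp]: "x \<in> tube V \<longleftrightarrow> x \<in> graded_part 0 \<and> body x \<in> V"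
  by (simp add: tube_def)

lemma body_image_tube [simp]: "body ` tube V = V"
proof
  show "V \<subseteq> body ` tube V"
  proof
    fix t assume "t \<in> V"
    then show "t \<in> body ` tube V" by (intro image_eqI[of _ _ "of_real t"]) simp_all
  qed
qed auto

lemma tube_eq_iff [simp]: "tube V = tube W \<longleftrightarrow> V = W"
  using arg_cong[of "tube V" "tube W" "image body", unfolded body_image_tube] by blast

lemma tube_Int: "tube V \<inter> tube W = tube (V \<inter> W)"
  by auto

lemma dewitt_open_iff: "dewitt_open U \<longleftrightarrow> (\<exists>V. open V \<and> U = tube V)"
  by (simp add: dewitt_open_def tube_def)

lemma dewitt_open_tube: "open V \<Longrightarrow> dewitt_open (tube V)"
  using dewitt_open_iff by blast

lemma dewitt_open_Int: "dewitt_open U \<Longrightarrow> dewitt_open W \<Longrightarrow> dewitt_open (U \<inter> W)"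
  unfolding dewitt_open_iff by (metis open_Int tube_Int)

lemma G_inftyI:
  "open V \<Longrightarrow> U = tube V \<Longrightarrow> smooth_on V f \<Longrightarrow> (\<And>x. x \<in> U \<Longrightarrow> F x = G_extension f x) \<Longrightarrow> G_infty U F"
  unfolding G_infty_def by (intro conjI exI[of _ f] ballI) (simp_all add: dewitt_open_tube)

lemma G_extension_restrict:
  assumes "open V" "smooth_on V f" "\<And>x. x \<in> tube V \<Longrightarrow> F x = G_extension f x" "t \<in> V"
  shows "F (of_real t) = f t"
  using assms by (simp add: G_extension_at_real[of V])

text \<open>
  A G-infinity function is the extension of its own restriction to the reals. This makes the
  underlying smooth function canonical and lets derivatives be defined without choosing one.
\<close>

lemma G_inftyE:
  assumes "G_infty U F"
  obtains V where "open V" "U = tube V" "smooth_on V (\<lambda>t. F (of_real t))"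
    "\<And>x. x \<in> U \<Longrightarrow> F x = G_extension (\<lambda>t. F (of_real t)) x"
proof -
  from assms obtain V f where V: "open V" "U = tube V" and f: "smooth_on V f"
      "\<And>x. x \<in> tube V \<Longrightarrow> F x = G_extension f x"
    by (auto simp: G_infty_def dewitt_open_iff)
  note F = G_extension_restrict[OF V(1) f]
  show thesis
  proof (rule that[OF V])
    show "smooth_on V (\<lambda>t. F (of_real t))"
      by (rule smooth_on_cong[OF V(1) F f(1)])
    fix x assume x: "x \<in> U"
    then have "F x = G_extension f x" using f V by simp
    also have "\<dots> = G_extension (\<lambda>t. F (of_real t)) x"
      by (rule G_extension_cong[OF V(1)]) (use x V F in auto)
    finally show "F x = G_extension (\<lambda>t. F (of_real t)) x" .
  qed
qed

lemma G_infty_tubeD: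
  assumes "G_infty (tube V) F"
  shows "open V" "smooth_on V (\<lambda>t. F (of_real t))"
    "x \<in> tube V \<Longrightarrow> F x = G_extension (\<lambda>t. F (of_real t)) x"
  by (rule G_inftyE[OF assms]; simp)+

lemma G_infty_dewitt_open: "G_infty U F \<Longrightarrow> dewitt_open U"
  by (simp add: G_infty_def)

lemma G_infty_cong: "G_infty U F \<Longrightarrow> (\<And>x. x \<in> U \<Longrightarrow> F' x = F x) \<Longrightarrow> G_infty U F'"
  unfolding G_infty_def by auto

lemma G_infty_subset: "G_infty U F \<Longrightarrow> dewitt_open U' \<Longrightarrow> U' \<subseteq> U \<Longrightarrow> G_infty U' F"
  unfolding G_infty_def by (meson image_mono in_mono smooth_on_subset)

lemma G_infty_const: "dewitt_open U \<Longrightarrow> G_infty U (\<lambda>_. a)"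
  unfolding dewitt_open_iff by (auto intro: G_inftyI[where f = "\<lambda>_. a"] simp: smooth_on_const)

lemma G_infty_id: "dewitt_open U \<Longrightarrow> G_infty U (\<lambda>x. x)"
  unfolding dewitt_open_iff by (auto intro!: G_inftyI[where f = of_real] smooth_on_of_real smooth_real_id)

lemma G_infty_add:
  assumes "G_infty U F" "G_infty U G"
  shows "G_infty U (\<lambda>x. F x + G x)"
proof -
  obtain V where V: "open V" "U = tube V"
    using G_infty_dewitt_open[OF assms(1)] by (auto simp: dewitt_open_iff)
  note f = G_infty_tubeD(2,3)[OF assms(1)[unfolded V(2)]]
  note g = G_infty_tubeD(2,3)[OF assms(2)[unfolded V(2)]]
  show ?thesis
    by (rule G_inftyI[OF V smooth_on_add[OF V(1) f(1) g(1)]])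
       (use V(2) f g in \<open>simp add: G_extension_add[OF V(1) _ f(1) g(1)]\<close>)
qed

lemma G_infty_mult:
  assumes "G_infty U F" "G_infty U G"
  shows "G_infty U (\<lambda>x. F x * G x)"
proof -
  obtain V where V: "open V" "U = tube V"
    using G_infty_dewitt_open[OF assms(1)] by (auto simp: dewitt_open_iff)
  note f = G_infty_tubeD(2,3)[OF assms(1)[unfolded V(2)]]
  note g = G_infty_tubeD(2,3)[OF assms(2)[unfolded V(2)]]
  show ?thesis
    by (rule G_inftyI[OF V smooth_on_mult[OF V(1) f(1) g(1)]])
       (use V(2) f g in \<open>simp add: G_extension_mult[OF V(1) _ _ f(1) g(1)]\<close>)
qed

text \<open>
  Working with the restriction to the reals avoids choosing an underlying smooth function, so that
  the derivative depends on \<open>F\<close> only. It has a meaning at points around which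
  \<open>F\<close> is G-infinity.
\<close>

definition gderiv :: "(grassmann \<Rightarrow> grassmann) \<Rightarrow> grassmann \<Rightarrow> grassmann" where
  "gderiv F x = G_extension (nth_deriv 1 (\<lambda>t. F (of_real t))) x"

lemma gderiv_cong:
  assumes "dewitt_open U" "x \<in> U" "\<And>y. y \<in> U \<Longrightarrow> F y = G y"
  shows "gderiv F x = gderiv G x"
proof -
  obtain V where V: "open V" "U = tube V" using assms(1) by (auto simp: dewitt_open_iff)
  have "nth_deriv 1 (\<lambda>t. F (of_real t)) t = nth_deriv 1 (\<lambda>t. G (of_real t)) t" if "t \<in> V" for t
    by (rule nth_deriv_cong_open[OF V(1) _ that]) (use assms(3) V in auto)
  then show ?thesis
    unfolding gderiv_def using assms(2) V by (intro G_extension_cong[OF V(1)]) auto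
qed

lemma G_infty_gderiv:
  assumes "G_infty U F"
  shows "G_infty U (gderiv F)"
proof -
  obtain V where V: "open V" "U = tube V" "smooth_on V (\<lambda>t. F (of_real t))"
    by (rule G_inftyE[OF assms]) blast
  show ?thesis
    by (rule G_inftyI[OF V(1,2) smooth_on_nth_deriv[OF V(3), of 1]]) (simp add: gderiv_def)
qed

lemma gderiv_const [simp]: "gderiv (\<lambda>_. a) x = 0"
  by (simp add: gderiv_def)

lemma gderiv_id [simp]: "gderiv (\<lambda>x. x) x = 1"
proof -
  have "nth_deriv 1 (of_real :: real \<Rightarrow> grassmann) = (\<lambda>_. 1)"
    by (rule ext, rule grassmann_eqI)
       (simp add: coeff_nth_deriv coeff_simps coeff_of_real if_distrib[of "\<lambda>u. deriv u _"])
  then show ?thesis by (simp add: gderiv_def)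
qed

lemma gderiv_add:
  assumes "G_infty U F" "G_infty U G" "x \<in> U"
  shows "gderiv (\<lambda>x. F x + G x) x = gderiv F x + gderiv G x"
proof -
  obtain V where V: "open V" "U = tube V"
    using G_infty_dewitt_open[OF assms(1)] by (auto simp: dewitt_open_iff)
  note f = G_infty_tubeD(2,3)[OF assms(1)[unfolded V(2)]]
  note g = G_infty_tubeD(2,3)[OF assms(2)[unfolded V(2)]]
  have "gderiv (\<lambda>x. F x + G x) x =
      G_extension (\<lambda>t. nth_deriv 1 (\<lambda>t. F (of_real t)) t + nth_deriv 1 (\<lambda>t. G (of_real t)) t) x"
    unfolding gderiv_def
    by (rule G_extension_cong[OF V(1)]) (use assms(3) V(2) nth_deriv_add[OF V(1) f(1) g(1)] in simp_all)
  then show ?thesis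
    using assms(3) V(2) G_extension_add[OF V(1) _ smooth_on_nth_deriv[OF f(1)] smooth_on_nth_deriv[OF g(1)]]
    by (simp add: gderiv_def)
qed

lemma gderiv_mult:
  assumes "G_infty U F" "G_infty U G" "x \<in> U"
  shows "gderiv (\<lambda>x. F x * G x) x = gderiv F x * G x + F x * gderiv G x"
proof -
  obtain V where V: "open V" "U = tube V"
    using G_infty_dewitt_open[OF assms(1)] by (auto simp: dewitt_open_iff)
  note f = G_infty_tubeD(2,3)[OF assms(1)[unfolded V(2)]]
  note g = G_infty_tubeD(2,3)[OF assms(2)[unfolded V(2)]]
  let ?f = "\<lambda>t. F (of_real t)" and ?g = "\<lambda>t. G (of_real t)"
  have "gderiv (\<lambda>x. F x * G x) x = G_extension (\<lambda>t. nth_deriv 1 ?f t * ?g t + ?f t * nth_deriv 1 ?g t) x"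
    unfolding gderiv_def
    by (rule G_extension_cong[OF V(1)])
       (use assms(3) V(2) nth_deriv_1_mult[OF V(1) f(1) g(1)] in simp_all)
  also have "\<dots> = G_extension (nth_deriv 1 ?f) x * G_extension ?g x + G_extension ?f x * G_extension (nth_deriv 1 ?g) x"
    using assms(3) V(2) f(1) g(1)
    by (simp add: G_extension_add[OF V(1)] G_extension_mult[OF V(1)] smooth_on_mult[OF V(1)] smooth_on_nth_deriv)
  also have "\<dots> = gderiv F x * G x + F x * gderiv G x"
    using assms(3) V(2) f(2)[of x, symmetric] g(2)[of x, symmetric] by (simp add: gderiv_def)
  finally show ?thesis .
qed

lemma gderiv_cmult:
  assumes "G_infty U F" "x \<in> U"
  shows "gderiv (\<lambda>x. a * F x) x = a * gderiv F x"
  using gderiv_mult[OF G_infty_const assms, of a] G_infty_dewitt_open[OF assms(1)] by simp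

lemma gderiv_graded:
  assumes "dewitt_open U" "x \<in> U" "F ` U \<subseteq> graded_part i"
  shows "gderiv F x \<in> graded_part i"
proof -
  obtain V where V: "open V" "U = tube V" using assms(1) by (auto simp: dewitt_open_iff)
  have "nth_deriv 1 (\<lambda>t. F (of_real t)) t \<in> graded_part i" if "t \<in> V" for t
    by (rule nth_deriv_graded[OF V(1) _ that]) (use assms(3) V in auto)
  then show ?thesis
    unfolding gderiv_def using assms(2) V by (intro G_extension_graded[OF V(1)]) auto
qed

lemma smooth_on_homogeneous_part: "smooth_on V f \<Longrightarrow> smooth_on V (\<lambda>t. homogeneous_part i (f t))"
  unfolding smooth_on_iff
proof
  fix A assume "\<forall>A. smooth_real V (\<lambda>t. coeff (f t) A)"
  then show "smooth_real V (\<lambda>t. coeff (homogeneous_part i (f t)) A)"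
    by (cases "even (fcard A) \<longleftrightarrow> even i") (simp_all add: homogeneous_part_def smooth_real_const)
qed

text \<open>
  The heart of the argument, stated for functions of a real variable near the body of the point.
  With \<open>h\<close> the slope of \<open>f\<close> and \<open>m = t - b\<close>, the Leibniz rule
  gives \<open>\<delta> f = \<delta> m * h(x) + soul x * \<delta> h\<close>, and differentiating
  \<open>f = f b + m h\<close> gives \<open>f'(x) = h(x) + h'(x) * soul x\<close>. So the defect of
  \<open>f\<close> is the defect of \<open>h\<close> times the soul. The Leibniz rule is only
  applied with an even first factor, hence without signs, and the constant \<open>f b\<close> is
  homogeneous, hence killed, if \<open>f\<close> is.
\<close>

lemma derivation_determined_by_coordinate:
  fixes \<delta> :: "(real \<Rightarrow> grassmann) \<Rightarrow> grassmann"
  assumes B: "open B" "convex B" "body x \<in> B" and x: "x \<in> graded_part 0"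
    and add: "\<And>f g. smooth_on B f \<Longrightarrow> smooth_on B g \<Longrightarrow> \<delta> (\<lambda>t. f t + g t) = \<delta> f + \<delta> g"
    and cmult: "\<And>f a j. smooth_on B f \<Longrightarrow> a \<in> graded_part j \<Longrightarrow>
      \<delta> (\<lambda>t. a * f t) = (- 1) ^ (d * j) * a * \<delta> f"
    and leibniz: "\<And>f g j. smooth_on B f \<Longrightarrow> smooth_on B g \<Longrightarrow> \<forall>t\<in>B. f t \<in> graded_part 0 \<Longrightarrow>
      \<forall>t\<in>B. g t \<in> graded_part j \<Longrightarrow>
      \<delta> (\<lambda>t. f t * g t) = \<delta> f * G_extension g x + G_extension f x * \<delta> g"
    and f: "smooth_on B f"
  shows "\<delta> f = \<delta> of_real * G_extension (nth_deriv 1 f) x"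
proof -
  let ?b = "body x" and ?G = G_extension
  have "\<delta> (\<lambda>_. 1) = \<delta> (\<lambda>_. 1) + \<delta> (\<lambda>_. 1)"
    using leibniz[of "\<lambda>_. 1" "\<lambda>_. 1" 0] by (simp add: smooth_on_const)
  \<comment> \<open>Constants are killed: \<open>1 = 1 * 1\<close> gives \<open>\<delta> 1 = 2 \<delta> 1\<close>.\<close>
  then have one: "\<delta> (\<lambda>_. 1) = 0" by simp
  have const: "\<delta> (\<lambda>_. a) = 0" if "a \<in> graded_part j" for a j
    using cmult[OF smooth_on_const that, of 1] by (simp add: one)
  define m where "m t = (of_real (t - ?b) :: grassmann)" for t
  have sid: "smooth_on B of_real" by (intro smooth_on_of_real smooth_real_id)
  have m': "m = (\<lambda>t. of_real t + - of_real ?b)" by (simp add: m_def fun_eq_iff)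
  have sm: "smooth_on B m"
    unfolding m' by (intro smooth_on_add smooth_on_const B sid)
  have \<delta>m: "\<delta> m = \<delta> of_real"
    unfolding m' by (subst add[OF sid smooth_on_const]) (simp add: const[of _ 0] graded_part_uminus)
  have Gm: "?G m x = soul x"
    unfolding m' by (subst G_extension_add[OF B(1,3) sid smooth_on_const]) (simp add: soul_def)
  \<comment> \<open>The Leibniz rule is available for homogeneous functions only; slopes keep the parity.\<close>
  have hom: "\<delta> f = \<delta> of_real * ?G (nth_deriv 1 f) x"
    if f: "smooth_on B f" "\<forall>t\<in>B. f t \<in> graded_part i" for f i
  proof -
    have "\<delta> f - \<delta> of_real * ?G (nth_deriv 1 f) x = 0"
    proof (rule soul_descent[where S = "{f. smooth_on B f \<and> (\<forall>t\<in>B. f t \<in> graded_part i)}" and x = x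
          and err = "\<lambda>f. \<delta> f - \<delta> of_real * ?G (nth_deriv 1 f) x"])
      fix f assume "f \<in> {f. smooth_on B f \<and> (\<forall>t\<in>B. f t \<in> graded_part i)}"
      then have f: "smooth_on B f" "\<And>t. t \<in> B \<Longrightarrow> f t \<in> graded_part i" by auto
      let ?h = "slope ?b f"
      have h: "smooth_on B ?h" "\<forall>t\<in>B. ?h t \<in> graded_part i"
        using smooth_on_slope[OF B f(1)] slope_graded[OF B(1,3) f(2)] by auto
      have fh: "f = (\<lambda>t. f ?b + m t * ?h t)"
        by (rule ext, subst slope[of f _ ?b]) (simp add: m_def scaleR_conv_of_real)
      have "\<delta> f = \<delta> (\<lambda>_. f ?b) + \<delta> (\<lambda>t. m t * ?h t)"
        by (subst fh) (intro add smooth_on_const smooth_on_mult B(1) sm h(1))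
      also have "\<dots> = \<delta> of_real * ?G ?h x + soul x * \<delta> ?h"
        using const[OF f(2)[OF B(3)]] leibniz[OF sm h(1) _ h(2)] by (simp add: \<delta>m Gm m_def del: of_real_diff)
      finally have 1: "\<delta> f = \<delta> of_real * ?G ?h x + soul x * \<delta> ?h" .
      have "?G (nth_deriv 1 f) x = ?G (\<lambda>t. (t - ?b) *\<^sub>R nth_deriv 1 ?h t + ?h t) x"
      proof (rule G_extension_cong[OF B(1,3)])
        fix t assume t: "t \<in> B"
        have "nth_deriv 1 f t = nth_deriv 1 (\<lambda>t. f ?b + (t - ?b) *\<^sub>R ?h t) t"
          by (rule nth_deriv_cong_open[OF B(1) _ t]) (rule slope)
        also have "\<dots> = (t - ?b) *\<^sub>R nth_deriv 1 ?h t + ?h t"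
          using nth_deriv_linear_mult[OF B(1) h(1) t, of 1 ?b]
          by (subst nth_deriv_add[OF B(1) smooth_on_const smooth_on_linear_mult[OF B(1) h(1)] t])
             simp
        finally show "nth_deriv 1 f t = (t - ?b) *\<^sub>R nth_deriv 1 ?h t + ?h t" .
      qed
      also have "\<dots> = ?G (nth_deriv 1 ?h) x * soul x + ?G ?h x"
        by (subst G_extension_add[OF B(1,3) smooth_on_linear_mult[OF B(1) smooth_on_nth_deriv[OF h(1)]] h(1)])
           (simp add: G_extension_linear_mult[OF B(1,3) smooth_on_nth_deriv[OF h(1)]])
      finally have "\<delta> f - \<delta> of_real * ?G (nth_deriv 1 f) x =
          (\<delta> ?h - \<delta> of_real * ?G (nth_deriv 1 ?h) x) * soul x"
        unfolding 1 by (simp add: algebra_simps even_commute[OF even_soul[OF x], of "\<delta> ?h"])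
      with h show "\<exists>h\<in>{f. smooth_on B f \<and> (\<forall>t\<in>B. f t \<in> graded_part i)}.
          \<delta> f - \<delta> of_real * ?G (nth_deriv 1 f) x = (\<delta> h - \<delta> of_real * ?G (nth_deriv 1 h) x) * soul x"
        by blast
    qed (use f in auto)
    then show ?thesis by simp
  qed
  let ?f = "\<lambda>i t. homogeneous_part i (f t)"
  have p: "smooth_on B (?f i)" for i
    by (rule smooth_on_homogeneous_part[OF f])
  have ff: "f = (\<lambda>t. ?f 0 t + ?f 1 t)"
    by (rule ext) (rule homogeneous_decomposition[symmetric])
  have "\<delta> (?f i) = \<delta> of_real * ?G (nth_deriv 1 (?f i)) x" for i
    by (rule hom[where i = i, OF p]) simp
  then have "\<delta> f = \<delta> of_real * (?G (nth_deriv 1 (?f 0)) x + ?G (nth_deriv 1 (?f 1)) x)"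
    unfolding distrib_left by (subst ff, subst add[OF p p]) simp
  also have "?G (nth_deriv 1 (?f 0)) x + ?G (nth_deriv 1 (?f 1)) x =
      ?G (\<lambda>t. nth_deriv 1 (?f 0) t + nth_deriv 1 (?f 1) t) x"
    by (rule G_extension_add[symmetric, OF B(1,3) smooth_on_nth_deriv[OF p] smooth_on_nth_deriv[OF p]])
  also have "\<dots> = ?G (nth_deriv 1 f) x"
    by (rule G_extension_cong[OF B(1,3)], subst (2) ff) (rule nth_deriv_add[symmetric, OF B(1) p p])
  finally show ?thesis .
qed

section \<open>Germs and tangent vectors on a supercurve\<close>

text \<open>
  A supermanifold of dimension \<open>(1,0)\<close> whose coordinate changes are extensions of
  real-valued functions. Applied to a chart and itself, the last assumption says that chart images
  are DeWitt open.
\<close>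

locale real_supercurve =
  fixes M :: "'a set" and \<A> :: "'a atlas"
  assumes chart_cover: "p \<in> M \<Longrightarrow> \<exists>(C, \<phi>)\<in>\<A>. p \<in> C"
    and chart_subset: "(C, \<phi>) \<in> \<A> \<Longrightarrow> C \<subseteq> M"
    and chart_inj: "(C, \<phi>) \<in> \<A> \<Longrightarrow> inj_on \<phi> C"
    and transition: "(C, \<phi>) \<in> \<A> \<Longrightarrow> (C', \<phi>') \<in> \<A> \<Longrightarrow> \<exists>V u. open V \<and> \<phi>' ` (C \<inter> C') = tube V \<and>
      smooth_real V u \<and> (\<forall>q\<in>C \<inter> C'. \<phi> q = G_extension (\<lambda>t. of_real (u t)) (\<phi>' q))"
begin

lemma chart_image: "(C, \<phi>) \<in> \<A> \<Longrightarrow> dewitt_open (\<phi> ` C)"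
  using transition[of C \<phi> C \<phi>] dewitt_open_tube by force

lemma chart_even: "(C, \<phi>) \<in> \<A> \<Longrightarrow> q \<in> C \<Longrightarrow> \<phi> q \<in> graded_part 0"
  using chart_image[of C \<phi>] by (auto simp: dewitt_open_def)

lemma inv_chart [simp]: "(C, \<phi>) \<in> \<A> \<Longrightarrow> q \<in> C \<Longrightarrow> inv_into C \<phi> (\<phi> q) = q"
  by (simp add: chart_inj)

lemma super_open_Int:
  assumes "super_open M \<A> U" "super_open M \<A> W"
  shows "super_open M \<A> (U \<inter> W)"
  unfolding super_open_def
proof (intro conjI ballI)
  show "U \<inter> W \<subseteq> M" using assms by (auto simp: super_open_def)
  fix c assume "c \<in> \<A>"
  then obtain C \<phi> where c: "c = (C, \<phi>)" "(C, \<phi>) \<in> \<A>" by (cases c) auto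
  have "\<phi> ` ((U \<inter> W) \<inter> C) = \<phi> ` ((U \<inter> C) \<inter> (W \<inter> C))"
    by (rule arg_cong[of _ _ "image \<phi>"]) auto
  also have "\<dots> = \<phi> ` (U \<inter> C) \<inter> \<phi> ` (W \<inter> C)"
    by (rule inj_on_image_Int[OF chart_inj[OF c(2)]]) auto
  finally have "dewitt_open (\<phi> ` ((U \<inter> W) \<inter> C))"
    using assms c(2) by (auto simp: super_open_def intro: dewitt_open_Int)
  then show "case c of (C, \<phi>) \<Rightarrow> dewitt_open (\<phi> ` ((U \<inter> W) \<inter> C))"
    by (simp add: c)
qed

lemma super_openD: "super_open M \<A> U \<Longrightarrow> (C, \<phi>) \<in> \<A> \<Longrightarrow> dewitt_open (\<phi> ` (U \<inter> C))"
  by (auto simp: super_open_def)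

lemma G_infty_onD: "G_infty_on M \<A> U f \<Longrightarrow> (C, \<phi>) \<in> \<A> \<Longrightarrow> G_infty (\<phi> ` (U \<inter> C)) (f \<circ> inv_into C \<phi>)"
  by (auto simp: G_infty_on_def)

lemma G_infty_on_super_open: "G_infty_on M \<A> U f \<Longrightarrow> super_open M \<A> U"
  by (simp add: G_infty_on_def)

lemma G_infty_onI:
  assumes "super_open M \<A> U"
    and "\<And>C \<phi>. (C, \<phi>) \<in> \<A> \<Longrightarrow> G_infty (\<phi> ` (U \<inter> C)) (f \<circ> inv_into C \<phi>)"
  shows "G_infty_on M \<A> U f"
  using assms by (auto simp: G_infty_on_def)

lemma G_infty_on_subset:
  assumes "G_infty_on M \<A> U f" "super_open M \<A> W" "W \<subseteq> U"
  shows "G_infty_on M \<A> W f"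
proof (rule G_infty_onI[OF assms(2)])
  fix C \<phi> assume c: "(C, \<phi>) \<in> \<A>"
  show "G_infty (\<phi> ` (W \<inter> C)) (f \<circ> inv_into C \<phi>)"
    by (rule G_infty_subset[OF G_infty_onD[OF assms(1) c] super_openD[OF assms(2) c]]) (use assms(3) in auto)
qed

lemma G_infty_on_const: "super_open M \<A> U \<Longrightarrow> G_infty_on M \<A> U (\<lambda>_. a)"
  by (rule G_infty_onI) (auto simp: comp_def intro: G_infty_const super_openD)

lemma G_infty_on_add:
  assumes "G_infty_on M \<A> U f" "G_infty_on M \<A> V g"
  shows "G_infty_on M \<A> (U \<inter> V) (\<lambda>q. f q + g q)"
proof (rule G_infty_onI)
  show o: "super_open M \<A> (U \<inter> V)"
    using assms G_infty_on_super_open super_open_Int by blast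
  fix C \<phi> assume c: "(C, \<phi>) \<in> \<A>"
  have "G_infty_on M \<A> (U \<inter> V) f" "G_infty_on M \<A> (U \<inter> V) g"
    using assms o by (auto intro: G_infty_on_subset)
  from G_infty_add[OF this[THEN G_infty_onD, OF c]]
  show "G_infty (\<phi> ` (U \<inter> V \<inter> C)) ((\<lambda>q. f q + g q) \<circ> inv_into C \<phi>)"
    by (simp add: comp_def)
qed

lemma G_infty_on_mult:
  assumes "G_infty_on M \<A> U f" "G_infty_on M \<A> V g"
  shows "G_infty_on M \<A> (U \<inter> V) (\<lambda>q. f q * g q)"
proof (rule G_infty_onI)
  show o: "super_open M \<A> (U \<inter> V)"
    using assms G_infty_on_super_open super_open_Int by blast
  fix C \<phi> assume c: "(C, \<phi>) \<in> \<A>"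
  have "G_infty_on M \<A> (U \<inter> V) f" "G_infty_on M \<A> (U \<inter> V) g"
    using assms o by (auto intro: G_infty_on_subset)
  from G_infty_mult[OF this[THEN G_infty_onD, OF c]]
  show "G_infty (\<phi> ` (U \<inter> V \<inter> C)) ((\<lambda>q. f q * g q) \<circ> inv_into C \<phi>)"
    by (simp add: comp_def)
qed

lemma G_infty_on_cmult: "G_infty_on M \<A> U f \<Longrightarrow> G_infty_on M \<A> U (\<lambda>q. a * f q)"
  using G_infty_on_mult[OF G_infty_on_const[of U a], of U f] G_infty_on_super_open by simp

text \<open>
  A smooth function of one coordinate is G-infinity in every chart, by composition with the
  coordinate change. This supplies the local functions to which a derivation can be applied.
\<close>

lemma G_infty_on_chart_pullback:
  assumes c: "(C, \<phi>) \<in> \<A>" and N: "open N" "smooth_on N f"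
  shows "G_infty_on M \<A> {q\<in>C. body (\<phi> q) \<in> N} (\<lambda>q. G_extension f (\<phi> q))"
proof -
  let ?W = "{q\<in>C. body (\<phi> q) \<in> N}"
  have chart: "dewitt_open (\<phi>' ` (?W \<inter> C')) \<and>
      G_infty (\<phi>' ` (?W \<inter> C')) ((\<lambda>q. G_extension f (\<phi> q)) \<circ> inv_into C' \<phi>')"
    if c': "(C', \<phi>') \<in> \<A>" for C' \<phi>'
  proof -
    obtain V u where V: "open V" "\<phi>' ` (C \<inter> C') = tube V" and u: "smooth_real V u"
      and tr: "\<And>q. q \<in> C \<inter> C' \<Longrightarrow> \<phi> q = G_extension (\<lambda>t. of_real (u t)) (\<phi>' q)"
      using transition[OF c c'] by blast
    let ?V = "V \<inter> u -` N"
    have oV: "open ?V"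
      by (rule continuous_open_preimage[OF smooth_real_continuous_on[OF u] V(1) N(1)])
    have body: "body (\<phi> q) = u (body (\<phi>' q))" "\<phi>' q \<in> tube V" if "q \<in> C \<inter> C'" for q
    proof -
      show q: "\<phi>' q \<in> tube V" using that V(2) by blast
      then show "body (\<phi> q) = u (body (\<phi>' q))"
        unfolding tr[OF that] by (subst body_G_extension[OF V(1) _ smooth_on_of_real[OF u]]) auto
    qed
    have img: "\<phi>' ` (?W \<inter> C') = tube ?V"
    proof (intro equalityI subsetI)
      fix x assume "x \<in> \<phi>' ` (?W \<inter> C')"
      then show "x \<in> tube ?V" using body by auto
    next
      fix x assume x: "x \<in> tube ?V"
      then have "x \<in> \<phi>' ` (C \<inter> C')" using V(2) by simp
      then obtain q where "q \<in> C \<inter> C'" "x = \<phi>' q" by blast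
      with x body[of q] show "x \<in> \<phi>' ` (?W \<inter> C')" by auto
    qed
    have "G_infty (tube ?V) ((\<lambda>q. G_extension f (\<phi> q)) \<circ> inv_into C' \<phi>')"
    proof (rule G_inftyI[OF oV refl])
      show "smooth_on ?V (\<lambda>t. f (u t))"
        by (rule smooth_on_compose[OF oV _ N(2) smooth_real_subset[OF u]]) auto
      fix x assume x: "x \<in> tube ?V"
      then have "x \<in> \<phi>' ` (?W \<inter> C')" unfolding img .
      then obtain q where q: "q \<in> ?W \<inter> C'" "x = \<phi>' q" by blast
      have "G_extension (\<lambda>t. f (u t)) x = G_extension f (G_extension (\<lambda>t. of_real (u t)) x)"
        by (rule G_extension_compose[OF oV _ _ smooth_real_subset[OF u] N(1) _ N(2)]) (use x in auto)
      moreover have "\<phi> q = G_extension (\<lambda>t. of_real (u t)) x" "inv_into C' \<phi>' x = q"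
        using q tr[of q] c' by auto
      ultimately show "((\<lambda>q. G_extension f (\<phi> q)) \<circ> inv_into C' \<phi>') x = G_extension (\<lambda>t. f (u t)) x"
        by (simp only: comp_apply)
    qed
    then show ?thesis using img oV by (simp add: dewitt_open_tube)
  qed
  show ?thesis
  proof (rule G_infty_onI)
    show "super_open M \<A> ?W"
      unfolding super_open_def using chart chart_subset[OF c] by blast
  qed (use chart in blast)
qed

lemma G_infty_on_chart:
  assumes "(C, \<phi>) \<in> \<A>"
  shows "G_infty_on M \<A> C \<phi>"
  using G_infty_on_chart_pullback[OF assms open_UNIV smooth_on_of_real[OF smooth_real_id]] by simp

subsection \<open>Germs\<close>

lemma local_functions_iff: "(U, f) \<in> local_functions M \<A> p \<longleftrightarrow> p \<in> U \<and> G_infty_on M \<A> U f"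
  by (simp add: local_functions_def)

lemma germ_relI:
  assumes "(U, f) \<in> local_functions M \<A> p" "(V, g) \<in> local_functions M \<A> p"
    and "super_open M \<A> W" "p \<in> W" "W \<subseteq> U \<inter> V" "\<And>q. q \<in> W \<Longrightarrow> f q = g q"
  shows "((U, f), (V, g)) \<in> germ_rel M \<A> p"
  using assms unfolding germ_rel_def by blast

lemma equiv_germ_rel: "equiv (local_functions M \<A> p) (germ_rel M \<A> p)"
proof (rule equivI)
  show "germ_rel M \<A> p \<subseteq> local_functions M \<A> p \<times> local_functions M \<A> p"
    by (auto simp: germ_rel_def)
  show "refl_on (local_functions M \<A> p) (germ_rel M \<A> p)"
  proof (rule refl_onI)
    fix r assume "r \<in> local_functions M \<A> p"
    then show "(r, r) \<in> germ_rel M \<A> p"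
      by (cases r) (auto simp: local_functions_iff intro!: germ_relI[of _ _ _ _ _ "fst r"]
          dest: G_infty_on_super_open)
  qed
  show "sym (germ_rel M \<A> p)"
    by (rule symI) (fastforce simp: germ_rel_def)
  show "trans (germ_rel M \<A> p)"
  proof (rule transI)
    fix r s t assume rs: "(r, s) \<in> germ_rel M \<A> p" and st: "(s, t) \<in> germ_rel M \<A> p"
    obtain U f V g X h where [simp]: "r = (U, f)" "s = (V, g)" "t = (X, h)"
      by (cases r, cases s, cases t) blast
    obtain W W' where "super_open M \<A> W" "p \<in> W" "W \<subseteq> U \<inter> V" "\<And>q. q \<in> W \<Longrightarrow> f q = g q"
      "super_open M \<A> W'" "p \<in> W'" "W' \<subseteq> V \<inter> X" "\<And>q. q \<in> W' \<Longrightarrow> g q = h q"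
      using rs st unfolding germ_rel_def by auto
    moreover have "r \<in> local_functions M \<A> p" "t \<in> local_functions M \<A> p"
      using rs st by (auto simp: germ_rel_def)
    ultimately show "(r, t) \<in> germ_rel M \<A> p"
      by (auto intro!: germ_relI[of _ _ _ _ _ "W \<inter> W'"] super_open_Int)
  qed
qed

lemma germ_eqI:
  assumes "(U, f) \<in> local_functions M \<A> p" "(V, g) \<in> local_functions M \<A> p"
    and "super_open M \<A> W" "p \<in> W" "W \<subseteq> U \<inter> V" "\<And>q. q \<in> W \<Longrightarrow> f q = g q"
  shows "germ M \<A> p U f = germ M \<A> p V g"
  unfolding germ_def by (rule equiv_class_eq[OF equiv_germ_rel germ_relI[OF assms]])

lemma germ_in_germs: "(U, f) \<in> local_functions M \<A> p \<Longrightarrow> germ M \<A> p U f \<in> germs M \<A> p"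
  unfolding germ_def germs_def by (rule quotientI)

lemma germsE:
  assumes "G \<in> germs M \<A> p"
  obtains U f where "(U, f) \<in> local_functions M \<A> p" "G = germ M \<A> p U f"
  using assms unfolding germs_def germ_def by (auto elim!: quotientE)

lemma chart_local_function: "(C, \<phi>) \<in> \<A> \<Longrightarrow> p \<in> C \<Longrightarrow> (C, \<phi>) \<in> local_functions M \<A> p"
  by (simp add: local_functions_iff G_infty_on_chart)

subsection \<open>Superderivations\<close>

lemma superderivation_graded:
  "superderivation M \<A> p d D \<Longrightarrow> (U, f) \<in> local_functions M \<A> p \<Longrightarrow> f ` U \<subseteq> graded_part i \<Longrightarrow>
    D (germ M \<A> p U f) \<in> graded_part (d + i)"
  unfolding superderivation_def by blast

lemma superderivation_add:
  "superderivation M \<A> p d D \<Longrightarrow> (U, f) \<in> local_functions M \<A> p \<Longrightarrow> (V, g) \<in> local_functions M \<A> p \<Longrightarrow>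
    D (germ M \<A> p (U \<inter> V) (\<lambda>q. f q + g q)) = D (germ M \<A> p U f) + D (germ M \<A> p V g)"
  unfolding superderivation_def by blast

lemma superderivation_cmult:
  "superderivation M \<A> p d D \<Longrightarrow> (U, f) \<in> local_functions M \<A> p \<Longrightarrow> a \<in> graded_part j \<Longrightarrow>
    D (germ M \<A> p U (\<lambda>q. a * f q)) = (- 1) ^ (d * j) * a * D (germ M \<A> p U f)"
  unfolding superderivation_def by blast

lemma superderivation_mult:
  "superderivation M \<A> p d D \<Longrightarrow> (U, f) \<in> local_functions M \<A> p \<Longrightarrow> (V, g) \<in> local_functions M \<A> p \<Longrightarrow>
    f ` U \<subseteq> graded_part i \<Longrightarrow> g ` V \<subseteq> graded_part j \<Longrightarrow>
    D (germ M \<A> p (U \<inter> V) (\<lambda>q. f q * g q)) =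
      D (germ M \<A> p U f) * g p + (- 1) ^ (d * i) * f p * D (germ M \<A> p V g)"
  unfolding superderivation_def by blast

text \<open>
  Smooth functions near the body of \<open>\<phi> p\<close>, extended and pulled back along
  \<open>\<phi>\<close>, represent germs at \<open>p\<close>; on them the superderivation becomes a
  derivation in one real variable, which is determined by its value on the coordinate.
\<close>

lemma superderivation_in_chart:
  assumes D: "superderivation M \<A> p d D" and c: "(C, \<phi>) \<in> \<A>" "p \<in> C" and f: "(U, f) \<in> local_functions M \<A> p"
  shows "D (germ M \<A> p U f) = D (germ M \<A> p C \<phi>) * gderiv (f \<circ> inv_into C \<phi>) (\<phi> p)"
proof -
  let ?F = "f \<circ> inv_into C \<phi>" and ?x = "\<phi> p"
  have F: "G_infty (\<phi> ` (U \<inter> C)) ?F"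
    by (rule G_infty_onD[OF _ c(1)]) (use f in \<open>simp add: local_functions_iff\<close>)
  obtain V where V: "open V" "\<phi> ` (U \<inter> C) = tube V"
    using G_infty_dewitt_open[OF F] unfolding dewitt_open_iff by blast
  note F = G_infty_tubeD(2,3)[OF F[unfolded V(2)]]
  let ?f = "\<lambda>t. ?F (of_real t)"
  have x: "?x \<in> tube V" unfolding V(2)[symmetric] using f c(2) by (auto simp: local_functions_iff)
  then obtain B where B: "open B" "convex B" "body ?x \<in> B" "B \<subseteq> V"
    using open_contains_interval[OF V(1)] by auto
  \<comment> \<open>On \<open>W\<close> the given function is the pullback of an extension from an interval, where Hadamard's lemma applies.\<close>
  define W where "W = {q\<in>C. body (\<phi> q) \<in> B}"
  have pW: "p \<in> W" using B c by (simp add: W_def)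
  have ev: "\<phi> q \<in> graded_part 0" "body (\<phi> q) \<in> B" "q \<in> C" if "q \<in> W" for q
    using that chart_even[OF c(1)] by (auto simp: W_def)
  have WU: "W \<subseteq> U \<inter> C"
  proof
    fix q assume q: "q \<in> W"
    then have "\<phi> q \<in> \<phi> ` (U \<inter> C)" unfolding V(2) using ev[OF q] B(4) by auto
    then show "q \<in> U \<inter> C" using chart_inj[OF c(1)] ev(3)[OF q] by (auto simp: inj_on_def)
  qed
  let ?ext = "\<lambda>g q. G_extension g (\<phi> q)"
  have loc: "(W, ?ext g) \<in> local_functions M \<A> p" if "smooth_on B g" for g
    unfolding W_def local_functions_iff
    using G_infty_on_chart_pullback[OF c(1) B(1) that] pW[unfolded W_def] by simp
  have sW: "super_open M \<A> W"
    using loc[OF smooth_on_const] G_infty_on_super_open unfolding local_functions_iff by blast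
  have on_W: "germ M \<A> p W g = germ M \<A> p W h"
    if "G_infty_on M \<A> W g" "G_infty_on M \<A> W h" "\<And>q. q \<in> W \<Longrightarrow> g q = h q" for g h
    by (rule germ_eqI[OF _ _ sW pW]) (use that pW in \<open>auto simp: local_functions_iff\<close>)
  define \<delta> where "\<delta> g = D (germ M \<A> p W (?ext g))" for g
  have G: "G_infty_on M \<A> W (?ext g)" if "smooth_on B g" for g
    using loc[OF that] by (simp add: local_functions_iff)
  have "\<delta> ?f = \<delta> of_real * G_extension (nth_deriv 1 ?f) ?x"
  proof (rule derivation_determined_by_coordinate[where d = d, OF B(1-3)])
    show "?x \<in> graded_part 0" using x by simp
    show "smooth_on B ?f" using F(1) B(4) by (rule smooth_on_subset)
  next
    fix g h assume gh: "smooth_on B g" "smooth_on B h"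
    have "germ M \<A> p W (?ext (\<lambda>t. g t + h t)) = germ M \<A> p (W \<inter> W) (\<lambda>q. ?ext g q + ?ext h q)"
      unfolding Int_absorb
    proof (rule on_W)
      show "G_infty_on M \<A> W (\<lambda>q. ?ext g q + ?ext h q)"
        using G_infty_on_add[OF G[OF gh(1)] G[OF gh(2)]] by simp
    qed (use G[OF smooth_on_add[OF B(1) gh]] G_extension_add[OF B(1) _ gh] ev in auto)
    then show "\<delta> (\<lambda>t. g t + h t) = \<delta> g + \<delta> h"
      unfolding \<delta>_def using superderivation_add[OF D loc[OF gh(1)] loc[OF gh(2)]] by simp
  next
    fix g a j assume g: "smooth_on B g" and a: "a \<in> graded_part j"
    have "germ M \<A> p W (?ext (\<lambda>t. a * g t)) = germ M \<A> p W (\<lambda>q. a * ?ext g q)"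
      by (rule on_W[OF G[OF smooth_on_mult[OF B(1) smooth_on_const g]] G_infty_on_cmult[OF G[OF g]]])
         (use G_extension_cmult[OF B(1) _ g] ev in auto)
    then show "\<delta> (\<lambda>t. a * g t) = (- 1) ^ (d * j) * a * \<delta> g"
      unfolding \<delta>_def using superderivation_cmult[OF D loc[OF g] a] by simp
  next
    fix g h j assume gh: "smooth_on B g" "smooth_on B h"
      and gr: "\<forall>t\<in>B. g t \<in> graded_part 0" "\<forall>t\<in>B. h t \<in> graded_part j"
    have "germ M \<A> p W (?ext (\<lambda>t. g t * h t)) = germ M \<A> p (W \<inter> W) (\<lambda>q. ?ext g q * ?ext h q)"
      unfolding Int_absorb
    proof (rule on_W)
      show "G_infty_on M \<A> W (\<lambda>q. ?ext g q * ?ext h q)"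
        using G_infty_on_mult[OF G[OF gh(1)] G[OF gh(2)]] by simp
    qed (use G[OF smooth_on_mult[OF B(1) gh]] G_extension_mult[OF B(1) _ _ gh] ev in auto)
    moreover have "?ext g ` W \<subseteq> graded_part 0" "?ext h ` W \<subseteq> graded_part j"
      using gr ev by (auto intro!: G_extension_graded[OF B(1)])
    ultimately show "\<delta> (\<lambda>t. g t * h t) = \<delta> g * G_extension h ?x + G_extension g ?x * \<delta> h"
      unfolding \<delta>_def using superderivation_mult[OF D loc[OF gh(1)] loc[OF gh(2)]] by simp
  qed
  moreover have "\<delta> ?f = D (germ M \<A> p U f)"
    unfolding \<delta>_def
  proof (rule arg_cong[of _ _ D], rule germ_eqI[OF loc f sW pW])
    show "smooth_on B ?f" using F(1) B(4) by (rule smooth_on_subset)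
    fix q assume q: "q \<in> W"
    have "\<phi> q \<in> tube V" using ev[OF q] B(4) by auto
    from F(2)[OF this] show "?ext ?f q = f q" using c(1) ev(3)[OF q] by simp
  qed (use WU in auto)
  moreover have "\<delta> of_real = D (germ M \<A> p C \<phi>)"
    unfolding \<delta>_def
    by (rule arg_cong[of _ _ D], rule germ_eqI[OF loc chart_local_function[OF c] sW pW])
       (use WU in \<open>auto intro: smooth_on_of_real smooth_real_id\<close>)
  ultimately show ?thesis by (simp add: gderiv_def)
qed

lemma superderivationI:
  assumes "D \<in> extensional (germs M \<A> p)"
    and "\<And>U f i. (U, f) \<in> local_functions M \<A> p \<Longrightarrow> f ` U \<subseteq> graded_part i \<Longrightarrow>
      D (germ M \<A> p U f) \<in> graded_part (d + i)"
    and "\<And>U f V g. (U, f) \<in> local_functions M \<A> p \<Longrightarrow> (V, g) \<in> local_functions M \<A> p \<Longrightarrow>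
      D (germ M \<A> p (U \<inter> V) (\<lambda>q. f q + g q)) = D (germ M \<A> p U f) + D (germ M \<A> p V g)"
    and "\<And>U f j a. (U, f) \<in> local_functions M \<A> p \<Longrightarrow> a \<in> graded_part j \<Longrightarrow>
      D (germ M \<A> p U (\<lambda>q. a * f q)) = (- 1) ^ (d * j) * a * D (germ M \<A> p U f)"
    and "\<And>U f V g i j. (U, f) \<in> local_functions M \<A> p \<Longrightarrow> (V, g) \<in> local_functions M \<A> p \<Longrightarrow>
      f ` U \<subseteq> graded_part i \<Longrightarrow> g ` V \<subseteq> graded_part j \<Longrightarrow>
      D (germ M \<A> p (U \<inter> V) (\<lambda>q. f q * g q)) =
        D (germ M \<A> p U f) * g p + (- 1) ^ (d * i) * f p * D (germ M \<A> p V g)"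
  shows "superderivation M \<A> p d D"
  unfolding superderivation_def using assms by (intro conjI ballI allI impI; clarify) blast+

lemma local_functions_add:
  "(U, f) \<in> local_functions M \<A> p \<Longrightarrow> (V, g) \<in> local_functions M \<A> p \<Longrightarrow>
    (U \<inter> V, \<lambda>q. f q + g q) \<in> local_functions M \<A> p"
  by (simp add: local_functions_iff G_infty_on_add)

lemma local_functions_mult:
  "(U, f) \<in> local_functions M \<A> p \<Longrightarrow> (V, g) \<in> local_functions M \<A> p \<Longrightarrow>
    (U \<inter> V, \<lambda>q. f q * g q) \<in> local_functions M \<A> p"
  by (simp add: local_functions_iff G_infty_on_mult)

lemma local_functions_cmult:
  "(U, f) \<in> local_functions M \<A> p \<Longrightarrow> (U, \<lambda>q. a * f q) \<in> local_functions M \<A> p"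
  by (simp add: local_functions_iff G_infty_on_cmult)

text \<open>
  The derivative of an arbitrary representative; \<open>coordinate_derivation_germ\<close> shows
  that the choice does not matter.
\<close>

definition coordinate_derivation :: "'a set \<Rightarrow> ('a \<Rightarrow> grassmann) \<Rightarrow> 'a \<Rightarrow> 'a germ \<Rightarrow> grassmann" where
  "coordinate_derivation C \<phi> p =
    (\<lambda>G\<in>germs M \<A> p. gderiv (snd (SOME r. r \<in> G) \<circ> inv_into C \<phi>) (\<phi> p))"

lemma coordinate_derivation_germ:
  assumes c: "(C, \<phi>) \<in> \<A>" "p \<in> C" and f: "(U, f) \<in> local_functions M \<A> p"
  shows "coordinate_derivation C \<phi> p (germ M \<A> p U f) = gderiv (f \<circ> inv_into C \<phi>) (\<phi> p)"
proof -
  let ?r = "SOME r. r \<in> germ M \<A> p U f"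
  have "(U, f) \<in> germ M \<A> p U f"
    unfolding germ_def by (rule equiv_class_self[OF equiv_germ_rel f])
  then have "?r \<in> germ M \<A> p U f" by (rule someI)
  then have "((U, f), (fst ?r, snd ?r)) \<in> germ_rel M \<A> p"
    by (simp add: germ_def)
  then obtain W where W: "super_open M \<A> W" "p \<in> W" "\<And>q. q \<in> W \<Longrightarrow> f q = snd ?r q"
    unfolding germ_rel_def by blast
  have "gderiv (snd ?r \<circ> inv_into C \<phi>) (\<phi> p) = gderiv (f \<circ> inv_into C \<phi>) (\<phi> p)"
  proof (rule gderiv_cong[OF super_openD[OF W(1) c(1)]])
    show "\<phi> p \<in> \<phi> ` (W \<inter> C)" using W(2) c(2) by blast
    fix y assume "y \<in> \<phi> ` (W \<inter> C)"
    then obtain q where "q \<in> W" "q \<in> C" "y = \<phi> q" by blast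
    then show "(snd ?r \<circ> inv_into C \<phi>) y = (f \<circ> inv_into C \<phi>) y"
      using W(3)[of q] c(1) by simp
  qed
  then show ?thesis
    by (simp add: coordinate_derivation_def germ_in_germs[OF f])
qed

lemma superderivation_coordinate_derivation:
  assumes c: "(C, \<phi>) \<in> \<A>" "p \<in> C"
  shows "superderivation M \<A> p 0 (coordinate_derivation C \<phi> p)"
proof -
  have G: "G_infty (\<phi> ` (U \<inter> C)) (f \<circ> inv_into C \<phi>)" "\<phi> p \<in> \<phi> ` (U \<inter> C)"
    if "(U, f) \<in> local_functions M \<A> p" for U f
    using that c(2) G_infty_onD[OF _ c(1), of U f] by (auto simp: local_functions_iff)
  have G': "G_infty (\<phi> ` (U \<inter> V \<inter> C)) (f \<circ> inv_into C \<phi>)" "G_infty (\<phi> ` (U \<inter> V \<inter> C)) (g \<circ> inv_into C \<phi>)"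
    "\<phi> p \<in> \<phi> ` (U \<inter> V \<inter> C)"
    if fg: "(U, f) \<in> local_functions M \<A> p" "(V, g) \<in> local_functions M \<A> p" for U f V g
  proof -
    note o = G_infty_dewitt_open[OF G(1)[OF local_functions_add[OF fg]]]
    show "G_infty (\<phi> ` (U \<inter> V \<inter> C)) (f \<circ> inv_into C \<phi>)" "G_infty (\<phi> ` (U \<inter> V \<inter> C)) (g \<circ> inv_into C \<phi>)"
      by (rule G_infty_subset[OF G(1)[OF fg(1)] o], blast, rule G_infty_subset[OF G(1)[OF fg(2)] o], blast)
    show "\<phi> p \<in> \<phi> ` (U \<inter> V \<inter> C)" by (rule G(2)[OF local_functions_add[OF fg]])
  qed
  note germ = coordinate_derivation_germ[OF c]
  show ?thesis
  proof (rule superderivationI)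
    show "coordinate_derivation C \<phi> p \<in> extensional (germs M \<A> p)"
      by (simp add: coordinate_derivation_def)
  next
    fix U f i assume f: "(U, f) \<in> local_functions M \<A> p" "f ` U \<subseteq> graded_part i"
    have "(f \<circ> inv_into C \<phi>) ` \<phi> ` (U \<inter> C) \<subseteq> graded_part i"
      using f(2) c(1) by (auto simp: image_subset_iff)
    then show "coordinate_derivation C \<phi> p (germ M \<A> p U f) \<in> graded_part (0 + i)"
      using gderiv_graded[OF G_infty_dewitt_open[OF G(1)[OF f(1)]] G(2)[OF f(1)]] by (simp add: germ[OF f(1)])
  next
    fix U f V g assume fg: "(U, f) \<in> local_functions M \<A> p" "(V, g) \<in> local_functions M \<A> p"
    show "coordinate_derivation C \<phi> p (germ M \<A> p (U \<inter> V) (\<lambda>q. f q + g q)) =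
        coordinate_derivation C \<phi> p (germ M \<A> p U f) + coordinate_derivation C \<phi> p (germ M \<A> p V g)"
      using gderiv_add[OF G'[OF fg]]
      by (simp only: germ[OF local_functions_add[OF fg]] germ[OF fg(1)] germ[OF fg(2)] comp_def)
  next
    fix U f j and a :: grassmann assume f: "(U, f) \<in> local_functions M \<A> p"
    show "coordinate_derivation C \<phi> p (germ M \<A> p U (\<lambda>q. a * f q)) =
        (- 1) ^ (0 * j) * a * coordinate_derivation C \<phi> p (germ M \<A> p U f)"
      using gderiv_cmult[OF G[OF f], of a]
      by (simp add: germ[OF local_functions_cmult[OF f]] germ[OF f] comp_def)
  next
    fix U f V g i assume fg: "(U, f) \<in> local_functions M \<A> p" "(V, g) \<in> local_functions M \<A> p"
    have "inv_into C \<phi> (\<phi> p) = p" using c by simp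
    then show "coordinate_derivation C \<phi> p (germ M \<A> p (U \<inter> V) (\<lambda>q. f q * g q)) =
        coordinate_derivation C \<phi> p (germ M \<A> p U f) * g p +
        (- 1) ^ (0 * i) * f p * coordinate_derivation C \<phi> p (germ M \<A> p V g)"
      using gderiv_mult[OF G'[OF fg]]
      by (simp add: germ[OF local_functions_mult[OF fg]] germ[OF fg(1)] germ[OF fg(2)] comp_def)
  qed
qed

lemma tangent_scale_germ:
  "(U, f) \<in> local_functions M \<A> p \<Longrightarrow>
    tangent_scale M \<A> p l D (germ M \<A> p U f) = l * D (germ M \<A> p U f)"
  by (simp add: tangent_scale_def germ_in_germs)

text \<open>
  The scalar stands on the left, so moving it past homogeneous elements produces exactly the signs
  that turn an even derivation into one of the parity of the scalar.
\<close>

lemma superderivation_tangent_scale: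
  assumes D: "superderivation M \<A> p 0 D" and l: "l \<in> graded_part k"
  shows "superderivation M \<A> p k (tangent_scale M \<A> p l D)"
proof (rule superderivationI)
  show "tangent_scale M \<A> p l D \<in> extensional (germs M \<A> p)"
    by (simp add: tangent_scale_def)
next
  fix U f i assume f: "(U, f) \<in> local_functions M \<A> p" "f ` U \<subseteq> graded_part i"
  show "tangent_scale M \<A> p l D (germ M \<A> p U f) \<in> graded_part (k + i)"
    using graded_part_mult[OF l superderivation_graded[OF D f]] by (simp add: tangent_scale_germ[OF f(1)])
next
  fix U f V g assume fg: "(U, f) \<in> local_functions M \<A> p" "(V, g) \<in> local_functions M \<A> p"
  show "tangent_scale M \<A> p l D (germ M \<A> p (U \<inter> V) (\<lambda>q. f q + g q)) =
      tangent_scale M \<A> p l D (germ M \<A> p U f) + tangent_scale M \<A> p l D (germ M \<A> p V g)"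
    by (simp add: tangent_scale_germ fg local_functions_add superderivation_add[OF D fg] distrib_left)
next
  fix U f j and a :: grassmann assume f: "(U, f) \<in> local_functions M \<A> p" and a: "a \<in> graded_part j"
  have "tangent_scale M \<A> p l D (germ M \<A> p U (\<lambda>q. a * f q)) = l * a * D (germ M \<A> p U f)"
    using superderivation_cmult[OF D f a]
    by (simp add: tangent_scale_germ f local_functions_cmult mult.assoc)
  also have "\<dots> = (- 1) ^ (k * j) * a * tangent_scale M \<A> p l D (germ M \<A> p U f)"
    by (simp add: graded_commute[OF l a] tangent_scale_germ f mult.assoc)
  finally show "tangent_scale M \<A> p l D (germ M \<A> p U (\<lambda>q. a * f q)) =
      (- 1) ^ (k * j) * a * tangent_scale M \<A> p l D (germ M \<A> p U f)" .
next
  fix U f V g i j assume fg: "(U, f) \<in> local_functions M \<A> p" "(V, g) \<in> local_functions M \<A> p"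
    and gr: "f ` U \<subseteq> graded_part i" "g ` V \<subseteq> graded_part j"
  have fp: "f p \<in> graded_part i"
    using fg(1) gr(1) by (auto simp: local_functions_iff)
  have "tangent_scale M \<A> p l D (germ M \<A> p (U \<inter> V) (\<lambda>q. f q * g q)) =
      l * D (germ M \<A> p U f) * g p + l * f p * D (germ M \<A> p V g)"
    using superderivation_mult[OF D fg gr]
    by (simp add: tangent_scale_germ fg local_functions_mult distrib_left mult.assoc)
  also have "\<dots> = tangent_scale M \<A> p l D (germ M \<A> p U f) * g p +
      (- 1) ^ (k * i) * f p * tangent_scale M \<A> p l D (germ M \<A> p V g)"
    by (simp add: graded_commute[OF l fp] tangent_scale_germ fg mult.assoc)
  finally show "tangent_scale M \<A> p l D (germ M \<A> p (U \<inter> V) (\<lambda>q. f q * g q)) =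
      tangent_scale M \<A> p l D (germ M \<A> p U f) * g p +
      (- 1) ^ (k * i) * f p * tangent_scale M \<A> p l D (germ M \<A> p V g)" .
qed

text \<open>
  By \<open>superderivation_in_chart\<close> every tangent vector is its value on the coordinate
  times the coordinate derivation. The component of the field is an invertible even element, so it
  can be cancelled (injectivity) and divided by (surjectivity). A tangent vector of mixed parity is
  reached by a scalar of mixed parity.
\<close>

lemma trivial_if_nowhere_vanishing_field:
  assumes D: "\<And>p. p \<in> M \<Longrightarrow> superderivation M \<A> p 0 (D p)"
    and smooth: "\<And>C \<phi>. (C, \<phi>) \<in> \<A> \<Longrightarrow> G_infty (\<phi> ` C) ((\<lambda>p. D p (germ M \<A> p C \<phi>)) \<circ> inv_into C \<phi>)"
    and nonzero: "\<And>C \<phi> p. (C, \<phi>) \<in> \<A> \<Longrightarrow> p \<in> C \<Longrightarrow> body (D p (germ M \<A> p C \<phi>)) \<noteq> 0"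
  shows "trivial_tangent_bundle M \<A>"
  unfolding trivial_tangent_bundle_def
proof (intro exI conjI ballI allI impI)
  fix p assume "p \<in> M" then show "superderivation M \<A> p 0 (D p)" by (rule D)
next
  fix U f assume f: "G_infty_on M \<A> U f"
  show "G_infty_on M \<A> U (\<lambda>p. D p (germ M \<A> p U f))"
  proof (rule G_infty_onI[OF G_infty_on_super_open[OF f]])
    fix C \<phi> assume c: "(C, \<phi>) \<in> \<A>"
    let ?F = "f \<circ> inv_into C \<phi>" and ?w = "(\<lambda>p. D p (germ M \<A> p C \<phi>)) \<circ> inv_into C \<phi>"
    note F = G_infty_onD[OF f c]
    have "G_infty (\<phi> ` (U \<inter> C)) (\<lambda>x. ?w x * gderiv ?F x)"
      by (rule G_infty_mult[OF G_infty_subset[OF smooth[OF c] G_infty_dewitt_open[OF F]] G_infty_gderiv[OF F]])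
         blast
    then show "G_infty (\<phi> ` (U \<inter> C)) ((\<lambda>p. D p (germ M \<A> p U f)) \<circ> inv_into C \<phi>)"
    proof (rule G_infty_cong)
      fix x assume "x \<in> \<phi> ` (U \<inter> C)"
      then obtain p where p: "p \<in> U" "p \<in> C" "x = \<phi> p" by blast
      have "p \<in> M" using chart_subset[OF c] p(2) by blast
      then have "D p (germ M \<A> p U f) = D p (germ M \<A> p C \<phi>) * gderiv ?F (\<phi> p)"
        using p f by (intro superderivation_in_chart[OF D c]) (auto simp: local_functions_iff)
      then show "((\<lambda>p. D p (germ M \<A> p U f)) \<circ> inv_into C \<phi>) x = ?w x * gderiv ?F x"
        using p c by simp
    qed
  qed
next
  have even: "D p (germ M \<A> p C \<phi>) \<in> graded_part 0" if c: "(C, \<phi>) \<in> \<A>" "p \<in> C" for C \<phi> p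
  proof -
    have "p \<in> M" using chart_subset c by blast
    from superderivation_graded[OF D[OF this] chart_local_function[OF c], of 0]
    show ?thesis using chart_even[OF c(1)] by (simp add: image_subset_iff)
  qed
  show "bij_betw (\<lambda>(p, l). (p, tangent_scale M \<A> p l (D p))) (M \<times> UNIV) (tangent_bundle M \<A>)"
    unfolding bij_betw_def
  proof
    show "inj_on (\<lambda>(p, l). (p, tangent_scale M \<A> p l (D p))) (M \<times> UNIV)"
    proof (rule inj_onI, clarsimp)
      fix p l l' assume p: "p \<in> M" and eq: "tangent_scale M \<A> p l (D p) = tangent_scale M \<A> p l' (D p)"
      obtain C \<phi> where c: "(C, \<phi>) \<in> \<A>" "p \<in> C" using chart_cover[OF p] by blast
      from fun_cong[OF eq, of "germ M \<A> p C \<phi>"]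
      have "l * D p (germ M \<A> p C \<phi>) = l' * D p (germ M \<A> p C \<phi>)"
        by (simp add: tangent_scale_germ chart_local_function[OF c])
      then show "l = l'" by (rule even_cancel[OF even[OF c] nonzero[OF c]])
    qed
    show "(\<lambda>(p, l). (p, tangent_scale M \<A> p l (D p))) ` (M \<times> UNIV) = tangent_bundle M \<A>"
    proof (intro equalityI subsetI)
      fix v assume "v \<in> (\<lambda>(p, l). (p, tangent_scale M \<A> p l (D p))) ` (M \<times> UNIV)"
      then obtain p l where p: "p \<in> M" and v: "v = (p, tangent_scale M \<A> p l (D p))" by auto
      let ?D = "\<lambda>i. tangent_scale M \<A> p (homogeneous_part i l) (D p)"
      have "superderivation M \<A> p i (?D i)" for i
        by (rule superderivation_tangent_scale[OF D[OF p] homogeneous_part])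
      moreover have "tangent_scale M \<A> p l (D p) = (\<lambda>G\<in>germs M \<A> p. ?D 0 G + ?D 1 G)"
        by (simp add: tangent_scale_def fun_eq_iff restrict_def distrib_right[symmetric]
            homogeneous_decomposition[unfolded One_nat_def])
      ultimately show "v \<in> tangent_bundle M \<A>"
        unfolding tangent_bundle_def tangent_space_def using p v by blast
    next
      fix v assume "v \<in> tangent_bundle M \<A>"
      then obtain p D0 D1 where p: "p \<in> M" and D0: "superderivation M \<A> p 0 D0"
        and D1: "superderivation M \<A> p 1 D1" and v: "v = (p, \<lambda>G\<in>germs M \<A> p. D0 G + D1 G)"
        unfolding tangent_bundle_def tangent_space_def by blast
      obtain C \<phi> where c: "(C, \<phi>) \<in> \<A>" "p \<in> C" using chart_cover[OF p] by blast
      let ?g = "germ M \<A> p C \<phi>"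
      obtain b where b: "D p ?g * b = 1" using even_inverse[OF even[OF c] nonzero[OF c]] by blast
      define l where "l = (D0 ?g + D1 ?g) * b"
      have "b * D p ?g = 1" using b even_commute[OF even[OF c], of b] by simp
      then have l: "l * D p ?g = D0 ?g + D1 ?g" by (simp add: l_def mult.assoc)
      have "D0 G + D1 G = l * D p G" if G: "G \<in> germs M \<A> p" for G
      proof -
        obtain U f where f: "(U, f) \<in> local_functions M \<A> p" and Gf: "G = germ M \<A> p U f"
          by (rule germsE[OF G])
        have "D0 G + D1 G = l * D p ?g * gderiv (f \<circ> inv_into C \<phi>) (\<phi> p)"
          unfolding Gf superderivation_in_chart[OF D0 c f] superderivation_in_chart[OF D1 c f] l
          by (simp add: distrib_right)
        also have "\<dots> = l * D p G"
          unfolding Gf superderivation_in_chart[OF D[OF p] c f] by (simp add: mult.assoc)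
        finally show ?thesis .
      qed
      then have "v = (p, tangent_scale M \<A> p l (D p))"
        unfolding v tangent_scale_def by (simp cong: restrict_cong)
      with p show "v \<in> (\<lambda>(p, l). (p, tangent_scale M \<A> p l (D p))) ` (M \<times> UNIV)"
        by auto
    qed
  qed
qed

end

section \<open>The supercircle\<close>

text \<open>
  The two coordinate functions in either order. The four charts are treated alike:
  \<open>\<phi>\<close> is the chart map and \<open>\<pi>\<close> the other coordinate, whose sign
  selects the half circle.
\<close>

definition complementary :: "(grassmann \<times> grassmann \<Rightarrow> grassmann) \<Rightarrow> (grassmann \<times> grassmann \<Rightarrow> grassmann) \<Rightarrow> bool" where
  "complementary \<pi> \<phi> \<longleftrightarrow> \<pi> = fst \<and> \<phi> = snd \<or> \<pi> = snd \<and> \<phi> = fst"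

definition half_circle :: "(grassmann \<times> grassmann \<Rightarrow> grassmann) \<Rightarrow> real \<Rightarrow> (grassmann \<times> grassmann) set" where
  "half_circle \<pi> e = {p \<in> supercircle. e * body (\<pi> p) > 0}"

text \<open>
  The coordinate \<open>\<pi>\<close> on a half circle as a function of the coordinate
  \<open>\<phi>\<close>.
\<close>

definition height :: "real \<Rightarrow> grassmann \<Rightarrow> grassmann" where
  "height e = G_extension (\<lambda>t. of_real (e * sqrt (1 - t\<^sup>2)))"

abbreviation signs :: "real set" where "signs \<equiv> {1, - 1}"

lemma fst_neq_snd: "(fst :: grassmann \<times> grassmann \<Rightarrow> grassmann) \<noteq> snd"
proof
  assume "(fst :: grassmann \<times> grassmann \<Rightarrow> grassmann) = snd"
  from fun_cong[OF this, of "(0, 1)"] show False by simp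
qed

lemma complementary_cases:
  assumes "complementary \<pi> \<phi>" "complementary \<pi>' \<phi>'"
  shows "\<pi>' = \<pi> \<and> \<phi>' = \<phi> \<or> \<pi>' = \<phi> \<and> \<phi>' = \<pi>"
  using assms by (auto simp: complementary_def)

lemma supercircle_atlas_iff:
  "(C, \<phi>) \<in> supercircle_atlas \<longleftrightarrow> (\<exists>\<pi> e. complementary \<pi> \<phi> \<and> e \<in> signs \<and> C = half_circle \<pi> e)"
proof -
  have "half_circle fst 1 = {(x, y) \<in> supercircle. body x > 0}" "half_circle fst (- 1) = {(x, y) \<in> supercircle. - body x > 0}"
    "half_circle snd 1 = {(x, y) \<in> supercircle. body y > 0}" "half_circle snd (- 1) = {(x, y) \<in> supercircle. - body y > 0}"
    by (auto simp: half_circle_def)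
  then have atlas: "supercircle_atlas = {(half_circle fst 1, snd), (half_circle fst (- 1), snd),
      (half_circle snd 1, fst), (half_circle snd (- 1), fst)}"
    by (simp only: supercircle_atlas_def)
  show ?thesis
    unfolding atlas complementary_def by (simp, use fst_neq_snd in blast)
qed

lemma supercircleD:
  assumes "p \<in> supercircle" "complementary \<pi> \<phi>"
  shows "\<pi> p \<in> graded_part 0" "\<phi> p \<in> graded_part 0" "\<pi> p * \<pi> p + \<phi> p * \<phi> p = 1"
    "(body (\<pi> p))\<^sup>2 + (body (\<phi> p))\<^sup>2 = 1"
proof -
  show "\<pi> p \<in> graded_part 0" "\<phi> p \<in> graded_part 0" and eq: "\<pi> p * \<pi> p + \<phi> p * \<phi> p = 1"
    using assms by (auto simp: complementary_def supercircle_def power2_eq_square add.commute)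
  show "(body (\<pi> p))\<^sup>2 + (body (\<phi> p))\<^sup>2 = 1"
    using arg_cong[OF eq, of body] by (simp add: power2_eq_square)
qed

lemma supercircleI:
  assumes "x \<in> graded_part 0" "y \<in> graded_part 0" "x * x + y * y = 1" "complementary \<pi> \<phi>"
  obtains p where "p \<in> supercircle" "\<pi> p = x" "\<phi> p = y"
proof -
  have "(x, y) \<in> supercircle" "(y, x) \<in> supercircle"
    using assms(1-3) by (auto simp: supercircle_def power2_eq_square add.commute)
  then show thesis
    using assms(4) that[of "(x, y)"] that[of "(y, x)"] by (auto simp: complementary_def)
qed

lemma half_circleD:
  assumes "p \<in> half_circle \<pi> e" "complementary \<pi> \<phi>"
  shows "p \<in> supercircle" "\<phi> p \<in> tube {- 1<..<1}" "body (\<pi> p) \<noteq> 0"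
proof -
  show p: "p \<in> supercircle" and nz: "body (\<pi> p) \<noteq> 0"
    using assms(1) by (auto simp: half_circle_def)
  have "(body (\<phi> p))\<^sup>2 < 1"
    using supercircleD(4)[OF p assms(2)] nz by (smt (verit) zero_less_power2)
  then have "\<bar>body (\<phi> p)\<bar> < 1" by (simp add: abs_square_less_1)
  then show "\<phi> p \<in> tube {- 1<..<1}"
    using supercircleD(2)[OF p assms(2)] by auto
qed

lemma smooth_sqrt_one_minus_square: "smooth_real {- 1<..<1} (\<lambda>t. e * sqrt (1 - t\<^sup>2))"
proof (rule smooth_real_mult[OF open_greaterThanLessThan smooth_real_const])
  have pos: "1 + (- 1) * (t * t) \<in> {0<..}" if "t \<in> {- 1<..<1}" for t :: real
    using that abs_square_less_1[of t] by (auto simp: power2_eq_square)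
  have "smooth_real {- 1<..<1} (\<lambda>t. 1 + (- 1) * (t * t))"
    by (intro smooth_real_add smooth_real_mult smooth_real_const smooth_real_id open_greaterThanLessThan)
  from smooth_real_compose[OF open_greaterThanLessThan pos smooth_real_powr[of "1 / 2"] this]
  have "smooth_real {- 1<..<1} (\<lambda>t. (1 + (- 1) * (t * t)) powr (1 / 2))" by blast
  \<comment> \<open>A power function is smooth because its derivative is again a multiple of one.\<close>
  moreover have "sqrt (1 - t\<^sup>2) = (1 + (- 1) * (t * t)) powr (1 / 2)" if "t \<in> {- 1<..<1}" for t :: real
    using pos[OF that] by (simp add: powr_half_sqrt power2_eq_square)
  ultimately show "smooth_real {- 1<..<1} (\<lambda>t. sqrt (1 - t\<^sup>2))"
    by (rule smooth_real_cong[OF open_greaterThanLessThan, rotated])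
qed

lemma height:
  assumes x: "x \<in> tube {- 1<..<1}" and e: "e \<in> signs"
  shows "height e x \<in> graded_part 0" "height e x * height e x + x * x = 1"
    "e * body (height e x) > 0"
proof -
  let ?V = "{- 1<..<1} :: real set" and ?u = "\<lambda>t. e * sqrt (1 - t\<^sup>2)"
  let ?r = "\<lambda>t. of_real (?u t) :: grassmann"
  have V: "open ?V" by simp
  have b: "body x \<in> ?V" "x \<in> graded_part 0" using x by auto
  note s = smooth_on_of_real[OF smooth_sqrt_one_minus_square[of e]]
  have i: "smooth_on ?V of_real" by (intro smooth_on_of_real smooth_real_id)
  show "height e x \<in> graded_part 0"
    unfolding height_def by (rule G_extension_graded[OF V b]) (rule graded_part_of_real)
  have less: "t\<^sup>2 < 1" if "t \<in> ?V" for t :: real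
    using that abs_square_less_1[of t] by auto
  have "height e x * height e x + x * x = G_extension (\<lambda>t. ?r t * ?r t + of_real t * of_real t) x"
    unfolding height_def
    by (simp only: G_extension_add[OF V b(1) smooth_on_mult[OF V s s] smooth_on_mult[OF V i i]]
        G_extension_mult[OF V b s s] G_extension_mult[OF V b i i] G_extension_of_real)
  also have "\<dots> = G_extension (\<lambda>_. 1) x"
  proof (rule G_extension_cong[OF V b(1)])
    fix t assume t: "t \<in> ?V"
    have "?u t * ?u t + t * t = 1"
      using e less[OF t] by (auto simp: power2_eq_square)
    then show "?r t * ?r t + of_real t * of_real t = 1"
      by (metis of_real_1 of_real_add of_real_mult)
  qed
  finally show "height e x * height e x + x * x = 1" by simp
  show "e * body (height e x) > 0"
    unfolding height_def body_G_extension[OF V b(1) s] using e less[OF b(1)] by auto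
qed

text \<open>
  Two even square roots of one element whose bodies have the same sign agree: in \<open>(x - y)(x +
  y) = 0\<close> the second factor has nonzero body.
\<close>

lemma even_root_unique:
  assumes "x \<in> graded_part 0" "y \<in> graded_part 0" "x * x = y * y" "e * body x > 0" "e * body y > 0"
  shows "x = y"
proof -
  have eq: "(x - y) * (x + y) = 0 * (x + y)"
    using assms(3) by (simp add: algebra_simps even_commute[OF assms(1), of y])
  have "e * body (x + y) > 0"
    using assms(4,5) by (simp add: distrib_left)
  then have "body (x + y) \<noteq> 0" by auto
  from even_cancel[OF graded_part_add[OF assms(1,2)] this eq] show ?thesis by simp
qed

lemma height_eq:
  assumes "p \<in> half_circle \<pi> e" "complementary \<pi> \<phi>" "e \<in> signs"
  shows "\<pi> p = height e (\<phi> p)"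
proof (rule even_root_unique[of _ _ e])
  note c = supercircleD[OF half_circleD(1)[OF assms(1,2)] assms(2)]
  note h = height[OF half_circleD(2)[OF assms(1,2)] assms(3)]
  show "\<pi> p \<in> graded_part 0" "height e (\<phi> p) \<in> graded_part 0" "e * body (height e (\<phi> p)) > 0"
    by (rule c(1) h(1) h(3))+
  show "e * body (\<pi> p) > 0" using assms(1) by (simp add: half_circle_def)
  show "\<pi> p * \<pi> p = height e (\<phi> p) * height e (\<phi> p)"
    by (rule add_right_imp_eq[of _ "\<phi> p * \<phi> p"]) (simp only: c(3) h(2))
qed

lemma half_circle_image:
  assumes "complementary \<pi> \<phi>" "e \<in> signs"
  shows "\<phi> ` half_circle \<pi> e = tube {- 1<..<1}"
proof (intro equalityI subsetI)
  fix x assume x: "x \<in> tube {- 1<..<1}"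
  note h = height[OF x assms(2)]
  have "x \<in> graded_part 0" using x by simp
  then obtain p where "p \<in> supercircle" "\<pi> p = height e x" "\<phi> p = x"
    using supercircleI[OF h(1) _ h(2) assms(1)] by blast
  then show "x \<in> \<phi> ` half_circle \<pi> e"
    using h(3) by (intro image_eqI[of _ _ p]) (auto simp: half_circle_def)
qed (use half_circleD(2)[OF _ assms(1)] in blast)

lemma half_circle_inj:
  assumes "complementary \<pi> \<phi>" "e \<in> signs"
  shows "inj_on \<phi> (half_circle \<pi> e)"
proof (rule inj_onI)
  fix p q assume "p \<in> half_circle \<pi> e" "q \<in> half_circle \<pi> e" "\<phi> p = \<phi> q"
  moreover from this have "\<pi> p = \<pi> q"
    by (simp add: height_eq[OF _ assms])
  ultimately show "p = q"
    using assms(1) by (auto simp: complementary_def prod_eq_iff)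
qed

lemma half_circle_sgn:
  assumes "p \<in> supercircle" "body (\<pi> p) \<noteq> 0"
  shows "p \<in> half_circle \<pi> (sgn (body (\<pi> p)))" "sgn (body (\<pi> p)) \<in> signs"
  using assms by (auto simp: half_circle_def sgn_if)

lemma half_circle_sign_unique:
  assumes "p \<in> half_circle \<pi> e" "p \<in> half_circle \<pi> e'" "e \<in> signs" "e' \<in> signs"
  shows "e = e'"
  using assms by (auto simp: half_circle_def)

text \<open>
  If the charts use the same coordinate, the coordinate change is the identity on the same half
  circle and has empty domain on opposite ones. If they use different coordinates, it is the square
  root that describes the second half circle, on the part of the circle selected by both signs.
\<close>

lemma supercircle_transition:
  assumes c: "(C, \<phi>) \<in> supercircle_atlas" and c': "(C', \<phi>') \<in> supercircle_atlas"
  shows "\<exists>V u. open V \<and> \<phi>' ` (C \<inter> C') = tube V \<and> smooth_real V u \<and>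
    (\<forall>q\<in>C \<inter> C'. \<phi> q = G_extension (\<lambda>t. of_real (u t)) (\<phi>' q))"
proof -
  from c obtain \<pi> e where \<pi>: "complementary \<pi> \<phi>" "e \<in> signs" and C: "C = half_circle \<pi> e"
    unfolding supercircle_atlas_iff by blast
  from c' obtain \<pi>' e' where \<pi>': "complementary \<pi>' \<phi>'" "e' \<in> signs" and C': "C' = half_circle \<pi>' e'"
    unfolding supercircle_atlas_iff by blast
  from complementary_cases[OF \<pi>(1) \<pi>'(1)] show ?thesis
  proof
    assume same: "\<pi>' = \<pi> \<and> \<phi>' = \<phi>"
    define V where "V = (if e' = e then {- 1<..<1} else {} :: real set)"
    have "\<phi>' ` (C \<inter> C') = tube V"
    proof (cases "e' = e")
      case True
      then show ?thesis using half_circle_image[OF \<pi>] same by (simp add: V_def C C')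
    next
      case False
      then have "C \<inter> C' = {}"
        using half_circle_sign_unique[of _ \<pi> e e'] \<pi>(2) \<pi>'(2) same by (auto simp: C C')
      with False show ?thesis by (simp add: V_def tube_def)
    qed
    moreover have "open V" by (simp add: V_def)
    ultimately show ?thesis
      using same by (intro exI[of _ V] exI[of _ "\<lambda>t. t"]) (simp add: smooth_real_id)
  next
    assume other: "\<pi>' = \<phi> \<and> \<phi>' = \<pi>"
    let ?V = "{- 1<..<1} \<inter> {t. 0 < e * t}" and ?u = "\<lambda>t. e' * sqrt (1 - t\<^sup>2)"
    have "open ?V" by (intro open_Int open_greaterThanLessThan open_Collect_less continuous_intros)
    moreover have "\<phi>' ` (C \<inter> C') = tube ?V"
    proof (intro equalityI subsetI)
      fix x assume "x \<in> \<phi>' ` (C \<inter> C')"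
      then obtain q where q: "q \<in> C" "q \<in> C'" "x = \<phi>' q" by blast
      then have "x \<in> tube {- 1<..<1}" using half_circleD(2)[OF _ \<pi>'(1)] C' by blast
      moreover have "0 < e * body x" using q other by (simp add: C half_circle_def)
      ultimately show "x \<in> tube ?V" by simp
    next
      fix x assume x: "x \<in> tube ?V"
      then have "x \<in> \<phi>' ` C'" unfolding C' half_circle_image[OF \<pi>'] by simp
      then obtain q where q: "q \<in> C'" "x = \<phi>' q" by blast
      moreover have "q \<in> C"
        using q x other half_circleD(1)[OF _ \<pi>'(1), of q e'] by (simp add: C C' half_circle_def)
      ultimately show "x \<in> \<phi>' ` (C \<inter> C')" by blast
    qed
    moreover have "smooth_real ?V ?u"
      by (rule smooth_real_subset[OF smooth_sqrt_one_minus_square]) blast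
    moreover have "\<phi> q = G_extension (\<lambda>t. of_real (?u t)) (\<phi>' q)" if "q \<in> C \<inter> C'" for q
      using height_eq[OF _ \<pi>', of q] that other by (simp add: C' height_def)
    ultimately show ?thesis by blast
  qed
qed

interpretation circle: real_supercurve supercircle supercircle_atlas
proof
  fix p assume p: "p \<in> supercircle"
  have c: "complementary fst snd" "complementary snd fst" by (simp_all add: complementary_def)
  have "body (fst p) \<noteq> 0 \<or> body (snd p) \<noteq> 0"
    using supercircleD(4)[OF p c(1)] by auto
  then show "\<exists>(C, \<phi>)\<in>supercircle_atlas. p \<in> C"
  proof
    assume "body (fst p) \<noteq> 0"
    with half_circle_sgn[where \<pi> = fst, OF p this] c(1) show ?thesis
      by (intro bexI[of _ "(half_circle fst (sgn (body (fst p))), snd)"]) (auto simp: supercircle_atlas_iff)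
  next
    assume "body (snd p) \<noteq> 0"
    with half_circle_sgn[where \<pi> = snd, OF p this] c(2) show ?thesis
      by (intro bexI[of _ "(half_circle snd (sgn (body (snd p))), fst)"]) (auto simp: supercircle_atlas_iff)
  qed
next
  fix C and \<phi> :: "grassmann \<times> grassmann \<Rightarrow> grassmann"
  assume c: "(C, \<phi>) \<in> supercircle_atlas"
  then obtain \<pi> e where \<pi>: "complementary \<pi> \<phi>" "e \<in> signs" and C: "C = half_circle \<pi> e"
    unfolding supercircle_atlas_iff by blast
  show "C \<subseteq> supercircle" by (auto simp: C half_circle_def)
  show "inj_on \<phi> C" unfolding C by (rule half_circle_inj[OF \<pi>])
qed (rule supercircle_transition)

lemma half_circle_chart: "complementary \<pi> \<phi> \<Longrightarrow> e \<in> signs \<Longrightarrow> (half_circle \<pi> e, \<phi>) \<in> supercircle_atlas"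
  unfolding supercircle_atlas_iff by blast

lemma G_infty_height:
  assumes "complementary \<pi> \<phi>" "e \<in> signs"
  shows "G_infty (\<phi> ` half_circle \<pi> e) (\<pi> \<circ> inv_into (half_circle \<pi> e) \<phi>)"
  unfolding half_circle_image[OF assms]
proof (rule G_inftyI[OF open_greaterThanLessThan refl smooth_on_of_real[OF smooth_sqrt_one_minus_square[of e]]])
  fix x assume "x \<in> tube {- 1<..<1}"
  then obtain p where p: "p \<in> half_circle \<pi> e" "x = \<phi> p"
    unfolding half_circle_image[OF assms, symmetric] by blast
  then show "(\<pi> \<circ> inv_into (half_circle \<pi> e) \<phi>) x = G_extension (\<lambda>t. of_real (e * sqrt (1 - t\<^sup>2))) x"
    using height_eq[OF p(1) assms] circle.inv_chart[OF half_circle_chart[OF assms] p(1)]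
    by (simp add: height_def)
qed

text \<open>
  Differentiate \<open>x\<^sup>2 + y\<^sup>2 = 1\<close> with respect to the chart coordinate.
\<close>

lemma gderiv_height:
  assumes c: "complementary \<pi> \<phi>" "e \<in> signs" and p: "p \<in> half_circle \<pi> e"
  shows "\<pi> p * gderiv (\<pi> \<circ> inv_into (half_circle \<pi> e) \<phi>) (\<phi> p) = - \<phi> p"
proof -
  let ?U = "\<phi> ` half_circle \<pi> e" and ?R = "\<pi> \<circ> inv_into (half_circle \<pi> e) \<phi>" and ?x = "\<phi> p"
  note inv = circle.inv_chart[OF half_circle_chart[OF c]]
  note R = G_infty_height[OF c]
  note U = G_infty_dewitt_open[OF R]
  have x: "?x \<in> ?U" using p by blast
  have Rx: "?R ?x = \<pi> p" using inv[OF p] by simp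
  have "gderiv (\<lambda>x. ?R x * ?R x + x * x) ?x = gderiv (\<lambda>_. 1) ?x"
  proof (rule gderiv_cong[OF U x])
    fix y assume "y \<in> ?U"
    then obtain q where q: "q \<in> half_circle \<pi> e" "y = \<phi> q" by blast
    then show "?R y * ?R y + y * y = 1"
      using inv[OF q(1)] supercircleD(3)[OF half_circleD(1)[OF q(1) c(1)] c(1)] by simp
  qed
  then have "gderiv ?R ?x * \<pi> p + \<pi> p * gderiv ?R ?x + (?x + ?x) = 0"
    by (simp only: gderiv_add[OF G_infty_mult[OF R R] G_infty_mult[OF G_infty_id[OF U] G_infty_id[OF U]] x]
        gderiv_mult[OF R R x] gderiv_mult[OF G_infty_id[OF U] G_infty_id[OF U] x] Rx gderiv_id gderiv_const
        mult_1_left mult_1_right)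
  moreover have "gderiv ?R ?x * \<pi> p = \<pi> p * gderiv ?R ?x"
    by (rule even_commute[symmetric, OF supercircleD(1)[OF half_circleD(1)[OF p c(1)] c(1)]])
  ultimately have "2 *\<^sub>R (\<pi> p * gderiv ?R ?x + ?x) = 0"
    by (simp add: scaleR_2 algebra_simps)
  then show ?thesis by (simp add: eq_neg_iff_add_eq_0)
qed

text \<open>
  The sign that distinguishes the components \<open>x\<close> and \<open>-y\<close> of the rotation
  field.
\<close>

definition orientation :: "(grassmann \<times> grassmann \<Rightarrow> grassmann) \<Rightarrow> grassmann" where
  "orientation \<pi> = (if \<pi> = fst then 1 else - 1)"

lemma orientation_complementary: "complementary \<pi> \<phi> \<Longrightarrow> orientation \<phi> = - orientation \<pi>"
  using fst_neq_snd by (auto simp: complementary_def orientation_def)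

text \<open>
  The rotation field near \<open>p\<close> in the chart with coordinate \<open>\<phi>\<close>, on
  the half circle that contains \<open>p\<close>.
\<close>

definition chart_rotation :: "(grassmann \<times> grassmann \<Rightarrow> grassmann) \<Rightarrow> (grassmann \<times> grassmann \<Rightarrow> grassmann) \<Rightarrow>
    grassmann \<times> grassmann \<Rightarrow> (grassmann \<times> grassmann) germ \<Rightarrow> grassmann" where
  "chart_rotation \<pi> \<phi> p = tangent_scale supercircle supercircle_atlas p (orientation \<pi> * \<pi> p)
    (circle.coordinate_derivation (half_circle \<pi> (sgn (body (\<pi> p)))) \<phi> p)"

text \<open>
  At a point that lies in charts of both kinds, either expression may be used; by
  \<open>rotation_component\<close> the result does not depend on this choice.
\<close>

definition rotation :: "grassmann \<times> grassmann \<Rightarrow> (grassmann \<times> grassmann) germ \<Rightarrow> grassmann" where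
  "rotation p = (if body (fst p) \<noteq> 0 then chart_rotation fst snd p else chart_rotation snd fst p)"

lemma rotation_cases:
  assumes "p \<in> supercircle"
  obtains \<pi> \<phi> where "complementary \<pi> \<phi>" "body (\<pi> p) \<noteq> 0" "rotation p = chart_rotation \<pi> \<phi> p"
proof (cases "body (fst p) = 0")
  case True
  then have "body (snd p) \<noteq> 0"
    using supercircleD(4)[OF assms, of fst snd] by (auto simp: complementary_def)
  with True that[of snd fst] show thesis by (simp add: complementary_def rotation_def)
next
  case False
  with that[of fst snd] show thesis by (simp add: complementary_def rotation_def)
qed

lemma superderivation_rotation:
  assumes p: "p \<in> supercircle"
  shows "superderivation supercircle supercircle_atlas p 0 (rotation p)"
proof -
  obtain \<pi> \<phi> where c: "complementary \<pi> \<phi>" "body (\<pi> p) \<noteq> 0" "rotation p = chart_rotation \<pi> \<phi> p"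
    using rotation_cases[OF p] by blast
  note half = half_circle_sgn[where \<pi> = \<pi>, OF p c(2)]
  have "orientation \<pi> \<in> graded_part 0" by (auto simp: orientation_def)
  then show ?thesis
    unfolding c(3) chart_rotation_def using supercircleD(1)[OF p c(1)]
    by (intro circle.superderivation_tangent_scale circle.superderivation_coordinate_derivation
        half_circle_chart half c(1)) auto
qed

text \<open>
  If the chart that defines the field at \<open>p\<close> uses the other coordinate, the component
  is obtained from \<open>gderiv_height\<close>.
\<close>

lemma rotation_component:
  assumes c: "complementary \<pi> \<phi>" "e \<in> signs" and p: "p \<in> half_circle \<pi> e"
  shows "rotation p (germ supercircle supercircle_atlas p (half_circle \<pi> e) \<phi>) = orientation \<pi> * \<pi> p"
proof -
  have ps: "p \<in> supercircle" using p by (simp add: half_circle_def)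
  obtain \<pi>' \<phi>' where c': "complementary \<pi>' \<phi>'" "body (\<pi>' p) \<noteq> 0" "rotation p = chart_rotation \<pi>' \<phi>' p"
    using rotation_cases[OF ps] by blast
  let ?e = "sgn (body (\<pi>' p))"
  note half = half_circle_sgn[where \<pi> = \<pi>', OF ps c'(2)]
  note chart' = half_circle_chart[OF c'(1) half(2)]
  note loc = circle.chart_local_function[OF half_circle_chart[OF c] p]
  have val: "rotation p (germ supercircle supercircle_atlas p (half_circle \<pi> e) \<phi>) =
      orientation \<pi>' * \<pi>' p * gderiv (\<phi> \<circ> inv_into (half_circle \<pi>' ?e) \<phi>') (\<phi>' p)"
    by (simp only: c'(3) chart_rotation_def circle.tangent_scale_germ[OF loc]
        circle.coordinate_derivation_germ[OF chart' half(1) loc])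
  from complementary_cases[OF c'(1) c(1)] show ?thesis
  proof
    assume same: "\<pi> = \<pi>' \<and> \<phi> = \<phi>'"
    have "gderiv (\<phi>' \<circ> inv_into (half_circle \<pi>' ?e) \<phi>') (\<phi>' p) = gderiv (\<lambda>x. x) (\<phi>' p)"
    proof (rule gderiv_cong[OF circle.chart_image[OF chart']])
      show "\<phi>' p \<in> \<phi>' ` half_circle \<pi>' ?e" using half(1) by blast
    qed (simp add: f_inv_into_f)
    then show ?thesis using val same by simp
  next
    assume other: "\<pi> = \<phi>' \<and> \<phi> = \<pi>'"
    have "orientation \<pi>' * \<pi>' p * gderiv (\<pi>' \<circ> inv_into (half_circle \<pi>' ?e) \<phi>') (\<phi>' p) = orientation \<pi>' * (- \<phi>' p)"
      unfolding mult.assoc gderiv_height[OF c'(1) half(2,1)] ..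
    then show ?thesis
      using val other orientation_complementary[OF c'(1)] by simp
  qed
qed

theorem proposition4p3: "trivial_tangent_bundle supercircle supercircle_atlas"
proof (rule circle.trivial_if_nowhere_vanishing_field)
  fix p assume "p \<in> supercircle"
  then show "superderivation supercircle supercircle_atlas p 0 (rotation p)" by (rule superderivation_rotation)
next
  fix C \<phi> assume "(C, \<phi>) \<in> supercircle_atlas"
  then obtain \<pi> e where c: "complementary \<pi> \<phi>" "e \<in> signs" and C: "C = half_circle \<pi> e"
    unfolding supercircle_atlas_iff by blast
  note inv = circle.inv_chart[OF half_circle_chart[OF c]]
  note R = G_infty_height[OF c]
  show "G_infty (\<phi> ` C) ((\<lambda>p. rotation p (germ supercircle supercircle_atlas p C \<phi>)) \<circ> inv_into C \<phi>)"
    unfolding C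
  proof (rule G_infty_cong[OF G_infty_mult[OF G_infty_const[OF G_infty_dewitt_open[OF R]] R]])
    fix x assume "x \<in> \<phi> ` half_circle \<pi> e"
    then obtain p where p: "p \<in> half_circle \<pi> e" "x = \<phi> p" by blast
    then show "((\<lambda>p. rotation p (germ supercircle supercircle_atlas p (half_circle \<pi> e) \<phi>)) \<circ> inv_into (half_circle \<pi> e) \<phi>) x =
        orientation \<pi> * (\<pi> \<circ> inv_into (half_circle \<pi> e) \<phi>) x"
      by (simp add: inv[OF p(1)] rotation_component[OF c p(1)])
  qed
next
  fix C \<phi> and p :: "grassmann \<times> grassmann" assume "(C, \<phi>) \<in> supercircle_atlas" and p: "p \<in> C"
  then obtain \<pi> e where c: "complementary \<pi> \<phi>" "e \<in> signs" and C: "C = half_circle \<pi> e"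
    unfolding supercircle_atlas_iff by blast
  have "body (orientation \<pi> * \<pi> p) \<noteq> 0"
    using half_circleD(3)[OF p[unfolded C] c(1)] by (simp add: orientation_def)
  then show "body (rotation p (germ supercircle supercircle_atlas p C \<phi>)) \<noteq> 0"
    unfolding C using rotation_component[OF c] p C by simp
qed

end
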